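(* Let $C$ be a coalgebra over a field $K$ such that, for every finitely generated left $C^*$-module $M$, the rational part $\mathrm{Rat}(M)$ is a direct summand of $M$. Then there are only finitely many isomorphism types of simple left $C$-comodules; equivalently, the coradical $C_0$ of $C$ is finite dimensional.
   Context: $C$ is a coalgebra over a field $K$ with comultiplication $\Delta(c)=c_1\otimes c_2$ (Sweedler notation) and counit $\varepsilon$; $C^*=\mathrm{Hom}_K(C,K)$ is the dual algebra with convolution product $(fg)(c)=f(c_1)g(c_2)$. Right $C$-comodules are regarded as left $C^*$-modules via $f\cdot m=f(m_1)m_0$; left $C^*$-modules arising this way are called rational. For a left $C^*$-module $M$, $\mathrm{Rat}(M)$ is the sum of all rational submodules of $M$; equivalently $m\in\mathrm{Rat}(M)$ iff there are finitely many $m_i\in M$, $c_i\in C$ with $f\cdot m=\sum_i f(c_i)m_i$ for all $f\in C^*$. The coradical $C_0$ is the sum of all simple subcomodules of $C$ (equivalently, of all simple subcoalgebras). *)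

theory Defs
  imports Complex_Main "HOL-Library.Function_Algebras"
begin

text \<open>
  A vector space over the field \<open>'k\<close> is given by its scalar multiplication (library locale
  \<^locale>\<open>vector_space\<close>). A list \<open>[(a\<^sub>1, b\<^sub>1), \<dots>, (a\<^sub>n, b\<^sub>n)]\<close> stands for the tensor
  \<open>\<Sum>\<^sub>i a\<^sub>i \<otimes> b\<^sub>i\<close>; the tensor product is the set of all such formal sums modulo the congruence
  generated by bilinearity. A map into a tensor product is given by a choice of representatives,
  so that all equations between tensors are stated with \<open>tensor_eq\<close> and \<open>tensor3_eq\<close>, never with
  equality of lists.
\<close>

inductive sum_cong :: "('x list \<Rightarrow> 'x list \<Rightarrow> bool) \<Rightarrow> 'x list \<Rightarrow> 'x list \<Rightarrow> bool"
  for R :: "'x list \<Rightarrow> 'x list \<Rightarrow> bool" where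
  base: "R s t \<Longrightarrow> sum_cong R s t"
| refl: "sum_cong R s s"
| sym: "sum_cong R s t \<Longrightarrow> sum_cong R t s"
| trans: "sum_cong R s t \<Longrightarrow> sum_cong R t u \<Longrightarrow> sum_cong R s u"
| append: "sum_cong R s s' \<Longrightarrow> sum_cong R t t' \<Longrightarrow> sum_cong R (s @ t) (s' @ t')"
| commute: "sum_cong R (s @ t) (t @ s)"

inductive bilinear_rel ::
  "('k::field \<Rightarrow> 'a::ab_group_add \<Rightarrow> 'a) \<Rightarrow> ('k \<Rightarrow> 'b::ab_group_add \<Rightarrow> 'b) \<Rightarrow>
   ('a \<times> 'b) list \<Rightarrow> ('a \<times> 'b) list \<Rightarrow> bool"
  for sA :: "'k \<Rightarrow> 'a \<Rightarrow> 'a" and sB :: "'k \<Rightarrow> 'b \<Rightarrow> 'b" where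
  zero: "bilinear_rel sA sB [(0, y)] []"
| add1: "bilinear_rel sA sB [(x + x', y)] [(x, y), (x', y)]"
| add2: "bilinear_rel sA sB [(x, y + y')] [(x, y), (x, y')]"
| scale: "bilinear_rel sA sB [(sA a x, y)] [(x, sB a y)]"

inductive trilinear_rel ::
  "('k::field \<Rightarrow> 'a::ab_group_add \<Rightarrow> 'a) \<Rightarrow> ('k \<Rightarrow> 'b::ab_group_add \<Rightarrow> 'b) \<Rightarrow>
   ('k \<Rightarrow> 'd::ab_group_add \<Rightarrow> 'd) \<Rightarrow> ('a \<times> 'b \<times> 'd) list \<Rightarrow> ('a \<times> 'b \<times> 'd) list \<Rightarrow> bool"
  for sA :: "'k \<Rightarrow> 'a \<Rightarrow> 'a" and sB :: "'k \<Rightarrow> 'b \<Rightarrow> 'b" and sD :: "'k \<Rightarrow> 'd \<Rightarrow> 'd" where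
  zero: "trilinear_rel sA sB sD [(0, y, z)] []"
| add1: "trilinear_rel sA sB sD [(x + x', y, z)] [(x, y, z), (x', y, z)]"
| add2: "trilinear_rel sA sB sD [(x, y + y', z)] [(x, y, z), (x, y', z)]"
| add3: "trilinear_rel sA sB sD [(x, y, z + z')] [(x, y, z), (x, y, z')]"
| scale12: "trilinear_rel sA sB sD [(sA a x, y, z)] [(x, sB a y, z)]"
| scale23: "trilinear_rel sA sB sD [(x, sB a y, z)] [(x, y, sD a z)]"

definition tensor_eq ::
  "('k::field \<Rightarrow> 'a::ab_group_add \<Rightarrow> 'a) \<Rightarrow> ('k \<Rightarrow> 'b::ab_group_add \<Rightarrow> 'b) \<Rightarrow>
   ('a \<times> 'b) list \<Rightarrow> ('a \<times> 'b) list \<Rightarrow> bool" where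
  "tensor_eq sA sB = sum_cong (bilinear_rel sA sB)"

definition tensor3_eq ::
  "('k::field \<Rightarrow> 'a::ab_group_add \<Rightarrow> 'a) \<Rightarrow> ('k \<Rightarrow> 'b::ab_group_add \<Rightarrow> 'b) \<Rightarrow>
   ('k \<Rightarrow> 'd::ab_group_add \<Rightarrow> 'd) \<Rightarrow> ('a \<times> 'b \<times> 'd) list \<Rightarrow> ('a \<times> 'b \<times> 'd) list \<Rightarrow> bool" where
  "tensor3_eq sA sB sD = sum_cong (trilinear_rel sA sB sD)"

definition linear_into_tensor ::
  "('k::field \<Rightarrow> 'v::ab_group_add \<Rightarrow> 'v) \<Rightarrow> ('k \<Rightarrow> 'a::ab_group_add \<Rightarrow> 'a) \<Rightarrow>
   ('k \<Rightarrow> 'b::ab_group_add \<Rightarrow> 'b) \<Rightarrow> 'v set \<Rightarrow> ('v \<Rightarrow> ('a \<times> 'b) list) \<Rightarrow> bool" where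
  "linear_into_tensor sV sA sB V \<rho> \<longleftrightarrow>
     (\<forall>x\<in>V. \<forall>y\<in>V. tensor_eq sA sB (\<rho> (x + y)) (\<rho> x @ \<rho> y)) \<and>
     (\<forall>a. \<forall>x\<in>V. tensor_eq sA sB (\<rho> (sV a x)) (map (\<lambda>(u, v). (sA a u, v)) (\<rho> x)))"

definition finite_dim :: "('k::field \<Rightarrow> 'v::ab_group_add \<Rightarrow> 'v) \<Rightarrow> 'v set \<Rightarrow> bool" where
  "finite_dim sV V \<longleftrightarrow> (\<exists>B. finite B \<and> V = module.span sV B)"

locale coalgebra = vector_space scale
  for scale :: "'k::field \<Rightarrow> 'c::ab_group_add \<Rightarrow> 'c" +
  fixes \<Delta> :: "'c \<Rightarrow> ('c \<times> 'c) list"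
    and \<epsilon> :: "'c \<Rightarrow> 'k"
  assumes comult_linear: "linear_into_tensor scale scale scale UNIV \<Delta>"
    and counit_linear: "Vector_Spaces.linear scale (*) \<epsilon>"
    and coassoc: "tensor3_eq scale scale scale
          [(u, v, y). (x, y) \<leftarrow> \<Delta> c, (u, v) \<leftarrow> \<Delta> x]
          [(x, u, v). (x, y) \<leftarrow> \<Delta> c, (u, v) \<leftarrow> \<Delta> y]"
    and counit_left: "(\<Sum>(x, y)\<leftarrow>\<Delta> c. scale (\<epsilon> x) y) = c"
    and counit_right: "(\<Sum>(x, y)\<leftarrow>\<Delta> c. scale (\<epsilon> y) x) = c"
begin

definition dual :: "('c \<Rightarrow> 'k) set" where
  "dual = {f. Vector_Spaces.linear scale (*) f}"

definition conv :: "('c \<Rightarrow> 'k) \<Rightarrow> ('c \<Rightarrow> 'k) \<Rightarrow> 'c \<Rightarrow> 'k" where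
  "conv f g = (\<lambda>c. \<Sum>(x, y)\<leftarrow>\<Delta> c. f x * g y)"

text \<open>
  The underlying space of a comodule or module is a subspace \<open>N\<close> of an ambient vector space;
  every vector space is a subspace of itself, so all comodules are covered when the ambient space
  is arbitrary. Structure maps are only constrained on \<open>N\<close>.
  As \<open>'k\<close> is a field, \<open>N \<otimes> C\<close> and \<open>C \<otimes> N\<close> are subspaces of the tensor products formed with the
  ambient space, hence tensors are compared there.
\<close>

definition right_comodule ::
  "('k \<Rightarrow> 'm::ab_group_add \<Rightarrow> 'm) \<Rightarrow> 'm set \<Rightarrow> ('m \<Rightarrow> ('m \<times> 'c) list) \<Rightarrow> bool" where
  "right_comodule sM N \<rho> \<longleftrightarrow>
     vector_space sM \<and> module.subspace sM N \<and>
     (\<forall>n\<in>N. fst ` set (\<rho> n) \<subseteq> N) \<and>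
     linear_into_tensor sM sM scale N \<rho> \<and>
     (\<forall>n\<in>N. tensor3_eq sM scale scale
        [(u, v, y). (x, y) \<leftarrow> \<rho> n, (u, v) \<leftarrow> \<rho> x]
        [(x, u, v). (x, y) \<leftarrow> \<rho> n, (u, v) \<leftarrow> \<Delta> y]) \<and>
     (\<forall>n\<in>N. (\<Sum>(x, y)\<leftarrow>\<rho> n. sM (\<epsilon> y) x) = n)"

definition left_comodule ::
  "('k \<Rightarrow> 'n::ab_group_add \<Rightarrow> 'n) \<Rightarrow> 'n set \<Rightarrow> ('n \<Rightarrow> ('c \<times> 'n) list) \<Rightarrow> bool" where
  "left_comodule sN N \<rho> \<longleftrightarrow>
     vector_space sN \<and> module.subspace sN N \<and>
     (\<forall>n\<in>N. snd ` set (\<rho> n) \<subseteq> N) \<and>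
     linear_into_tensor sN scale sN N \<rho> \<and>
     (\<forall>n\<in>N. tensor3_eq scale scale sN
        [(u, v, y). (x, y) \<leftarrow> \<rho> n, (u, v) \<leftarrow> \<Delta> x]
        [(x, u, v). (x, y) \<leftarrow> \<rho> n, (u, v) \<leftarrow> \<rho> y]) \<and>
     (\<forall>n\<in>N. (\<Sum>(x, y)\<leftarrow>\<rho> n. sN (\<epsilon> x) y) = n)"

definition left_subcomodule ::
  "('k \<Rightarrow> 'n::ab_group_add \<Rightarrow> 'n) \<Rightarrow> 'n set \<Rightarrow> ('n \<Rightarrow> ('c \<times> 'n) list) \<Rightarrow> 'n set \<Rightarrow> bool" where
  "left_subcomodule sN N \<rho> P \<longleftrightarrow>
     P \<subseteq> N \<and> module.subspace sN P \<and>
     (\<forall>p\<in>P. \<exists>t. snd ` set t \<subseteq> P \<and> tensor_eq scale sN (\<rho> p) t)"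

definition simple_left_subcomodule ::
  "('k \<Rightarrow> 'n::ab_group_add \<Rightarrow> 'n) \<Rightarrow> 'n set \<Rightarrow> ('n \<Rightarrow> ('c \<times> 'n) list) \<Rightarrow> 'n set \<Rightarrow> bool" where
  "simple_left_subcomodule sN N \<rho> S \<longleftrightarrow>
     left_subcomodule sN N \<rho> S \<and> S \<noteq> {0} \<and>
     (\<forall>P\<subseteq>S. left_subcomodule sN N \<rho> P \<longrightarrow> P = {0} \<or> P = S)"

definition simple_left_comodule ::
  "('k \<Rightarrow> 'n::ab_group_add \<Rightarrow> 'n) \<Rightarrow> 'n set \<times> ('n \<Rightarrow> ('c \<times> 'n) list) \<Rightarrow> bool" where
  "simple_left_comodule sN = (\<lambda>(N, \<rho>).
     left_comodule sN N \<rho> \<and> simple_left_subcomodule sN N \<rho> N)"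

definition left_comodule_iso ::
  "('k \<Rightarrow> 'n::ab_group_add \<Rightarrow> 'n) \<Rightarrow> 'n set \<times> ('n \<Rightarrow> ('c \<times> 'n) list) \<Rightarrow>
   'n set \<times> ('n \<Rightarrow> ('c \<times> 'n) list) \<Rightarrow> bool" where
  "left_comodule_iso sN = (\<lambda>(N, \<rho>) (N', \<rho>').
     \<exists>h. bij_betw h N N' \<and>
         (\<forall>x\<in>N. \<forall>y\<in>N. h (x + y) = h x + h y) \<and>
         (\<forall>a. \<forall>x\<in>N. h (sN a x) = sN a (h x)) \<and>
         (\<forall>n\<in>N. tensor_eq scale sN (map (\<lambda>(x, y). (x, h y)) (\<rho> n)) (\<rho>' (h n))))"

definition simple_left_comodule_types ::
  "('k \<Rightarrow> 'n::ab_group_add \<Rightarrow> 'n) \<Rightarrow> ('n set \<times> ('n \<Rightarrow> ('c \<times> 'n) list)) set set" where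
  "simple_left_comodule_types sN =
     {X. simple_left_comodule sN X} //
     {(X, Y). simple_left_comodule sN X \<and> simple_left_comodule sN Y \<and> left_comodule_iso sN X Y}"

text \<open>The simple subcomodules are taken on the left; the right-hand version gives the same space.\<close>

definition coradical :: "'c set" where
  "coradical = span (\<Union>{S. simple_left_subcomodule scale UNIV \<Delta> S})"

definition left_dual_module ::
  "('k \<Rightarrow> 'm::ab_group_add \<Rightarrow> 'm) \<Rightarrow> 'm set \<Rightarrow> (('c \<Rightarrow> 'k) \<Rightarrow> 'm \<Rightarrow> 'm) \<Rightarrow> bool" where
  "left_dual_module sM M act \<longleftrightarrow>
     vector_space sM \<and> module.subspace sM M \<and>
     (\<forall>f\<in>dual. \<forall>m\<in>M. act f m \<in> M) \<and>
     (\<forall>f\<in>dual. \<forall>m\<in>M. \<forall>m'\<in>M. act f (m + m') = act f m + act f m') \<and>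
     (\<forall>f\<in>dual. \<forall>g\<in>dual. \<forall>m\<in>M. act (\<lambda>c. f c + g c) m = act f m + act g m) \<and>
     (\<forall>a. \<forall>f\<in>dual. \<forall>m\<in>M. act f (sM a m) = sM a (act f m)) \<and>
     (\<forall>a. \<forall>f\<in>dual. \<forall>m\<in>M. act (\<lambda>c. a * f c) m = sM a (act f m)) \<and>
     (\<forall>f\<in>dual. \<forall>g\<in>dual. \<forall>m\<in>M. act (conv f g) m = act f (act g m)) \<and>
     (\<forall>m\<in>M. act \<epsilon> m = m)"

definition dual_submodule ::
  "('k \<Rightarrow> 'm::ab_group_add \<Rightarrow> 'm) \<Rightarrow> 'm set \<Rightarrow> (('c \<Rightarrow> 'k) \<Rightarrow> 'm \<Rightarrow> 'm) \<Rightarrow> 'm set \<Rightarrow> bool" where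
  "dual_submodule sM M act N \<longleftrightarrow>
     N \<subseteq> M \<and> module.subspace sM N \<and> (\<forall>f\<in>dual. \<forall>n\<in>N. act f n \<in> N)"

definition finitely_generated ::
  "'m::ab_group_add set \<Rightarrow> (('c \<Rightarrow> 'k) \<Rightarrow> 'm \<Rightarrow> 'm) \<Rightarrow> bool" where
  "finitely_generated M act \<longleftrightarrow>
     (\<exists>X\<subseteq>M. finite X \<and> (\<forall>m\<in>M. \<exists>f. (\<forall>x\<in>X. f x \<in> dual) \<and> m = (\<Sum>x\<in>X. act (f x) x)))"

definition direct_summand ::
  "('k \<Rightarrow> 'm::ab_group_add \<Rightarrow> 'm) \<Rightarrow> 'm set \<Rightarrow> (('c \<Rightarrow> 'k) \<Rightarrow> 'm \<Rightarrow> 'm) \<Rightarrow> 'm set \<Rightarrow> bool" where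
  "direct_summand sM M act N \<longleftrightarrow>
     dual_submodule sM M act N \<and>
     (\<exists>P. dual_submodule sM M act P \<and> N \<inter> P = {0} \<and> (\<forall>m\<in>M. \<exists>n\<in>N. \<exists>p\<in>P. m = n + p))"

definition rational ::
  "('k \<Rightarrow> 'm::ab_group_add \<Rightarrow> 'm) \<Rightarrow> 'm set \<Rightarrow> (('c \<Rightarrow> 'k) \<Rightarrow> 'm \<Rightarrow> 'm) \<Rightarrow> bool" where
  "rational sM N act \<longleftrightarrow>
     (\<exists>\<rho>. right_comodule sM N \<rho> \<and>
          (\<forall>f\<in>dual. \<forall>n\<in>N. act f n = (\<Sum>(x, y)\<leftarrow>\<rho> n. sM (f y) x)))"

definition Rat ::
  "('k \<Rightarrow> 'm::ab_group_add \<Rightarrow> 'm) \<Rightarrow> 'm set \<Rightarrow> (('c \<Rightarrow> 'k) \<Rightarrow> 'm \<Rightarrow> 'm) \<Rightarrow> 'm set" where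
  "Rat sM M act =
     module.span sM (\<Union>{N. dual_submodule sM M act N \<and> rational sM N act})"

end

text \<open>
  A finitely generated left module over the dual algebra is a quotient of a finite power of it;
  choosing a linear complement of the kernel shows that it is isomorphic to a module whose
  underlying space is a subspace of \<open>nat \<Rightarrow> 'c \<Rightarrow> 'k\<close>. Quantifying over the modules carried by such
  subspaces therefore loses no finitely generated module up to isomorphism.
\<close>

definition scale_fun :: "'k::field \<Rightarrow> (nat \<Rightarrow> 'c \<Rightarrow> 'k) \<Rightarrow> nat \<Rightarrow> 'c \<Rightarrow> 'k" where
  "scale_fun a m = (\<lambda>i c. a * m i c)"

end

theory Submission
  imports Defs
begin

text \<open>
  Write \<open>c \<cdot> f = f(c\<^sub>1) c\<^sub>2\<close> for the right action of \<open>C\<^sup>*\<close> on \<open>C\<close>; its submodules are the left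
  subcomodules of \<open>C\<close>. The coradical \<open>C\<^sub>0\<close> is the sum of the simple ones, so its linear dual
  \<open>C\<^sub>0\<^sup>*\<close> is a left \<open>C\<^sup>*\<close>-module by \<open>(f \<cdot> m)(c) = m(c \<cdot> f)\<close>, and it is generated by the restriction
  of the counit. Splitting off the rational part of this single cyclic module already forces \<open>C\<^sub>0\<close>
  to be finite dimensional.

  For a simple left subcomodule \<open>T\<close>, let \<open>A\<close> be the space of its coefficients, that is, the
  common kernel in \<open>C\<close> of all functionals that annihilate \<open>T\<close>. It is a finite-dimensional subcoalgebra and,
  as a right module, a sum of copies of \<open>T\<close> (\<open>coeff_finite_dimensional\<close>, \<open>coeff_sum\<close>). Let \<open>E\<close> be
  the sum of the coefficient spaces of the simple subcomodules with another annihilator. A simple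
  submodule of a sum of simple modules is isomorphic to one of the summands (\<open>simple_in_sum\<close>), hence
  \<open>C\<^sub>0 = A \<oplus> E\<close>, and there is a functional \<open>f\<close> which is the counit on \<open>A\<close> and zero on \<open>E\<close>.
  Let \<open>C\<^sub>0\<^sup>* = Rat \<oplus> P\<close> and \<open>p \<in> P\<close>. The element \<open>f \<cdot> p\<close> agrees with \<open>p\<close> on \<open>A\<close> and vanishes on
  \<open>E\<close>. As \<open>A\<close> is finite dimensional, such an element is rational, so \<open>f \<cdot> p \<in> Rat \<inter> P = {0}\<close> and
  \<open>p\<close> vanishes on \<open>T\<close>. Since \<open>T\<close> was arbitrary, \<open>p = 0\<close>. Thus \<open>C\<^sub>0\<^sup>*\<close> is rational, in particular its
  generator is: there are finitely many \<open>m\<^sub>i\<close> and \<open>c\<^sub>i\<close> such that every functional \<open>f\<close> restricts to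
  \<open>\<Sum>\<^sub>i f(c\<^sub>i) m\<^sub>i\<close> on \<open>C\<^sub>0\<close>. A functional vanishing at all \<open>c\<^sub>i\<close> then vanishes on \<open>C\<^sub>0\<close>, which says that
  \<open>C\<^sub>0\<close> lies in the span of the \<open>c\<^sub>i\<close> (\<open>coradical_in_finite_span\<close>).

  For the comodule types, every simple left comodule embeds into \<open>C\<close>, hence into \<open>C\<^sub>0\<close>
  (\<open>simple_comodule_embeds\<close>), and pairwise non-isomorphic simple submodules are linearly
  independent, so the number of types is at most the dimension of \<open>C\<^sub>0\<close>.

  All equations between tensors are reduced to equations between vectors by contracting tensor
  factors with functionals; the lemmas \<open>tensor_eqI\<close> and \<open>tensor3_eqI\<close> say that nothing is lost in
  doing so.
\<close>

section \<open>Linear functionals\<close>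

lemma vector_space_mult: "vector_space ((*) :: 'k::field \<Rightarrow> 'k \<Rightarrow> 'k)"
  by unfold_locales (simp_all add: algebra_simps)

lemma sum_list_closed:
  assumes "0 \<in> U" and "\<And>x y. x \<in> U \<Longrightarrow> y \<in> U \<Longrightarrow> x + y \<in> U" and "\<forall>x\<in>set xs. g x \<in> U"
  shows "sum_list (map g xs) \<in> U"
  using assms(3) by (induction xs) (auto intro: assms(1,2))

lemma additive_sum_list:
  assumes "g 0 = 0" and "\<And>x y. g (x + y) = g x + g y"
  shows "g (sum_list (map h xs)) = sum_list (map (\<lambda>x. g (h x)) xs)"
  by (induction xs) (simp_all add: assms)

lemma sum_list_map_concat:
  "sum_list (map \<phi> (concat (map F xs))) = (\<Sum>x\<leftarrow>xs. sum_list (map \<phi> (F x)))"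
  by (induction xs) simp_all

lemma additive_on_sum_list:
  assumes "0 \<in> U" and "\<And>x y. x \<in> U \<Longrightarrow> y \<in> U \<Longrightarrow> x + y \<in> U"
    and "g 0 = 0" and "\<And>x y. x \<in> U \<Longrightarrow> y \<in> U \<Longrightarrow> g (x + y) = g x + g y"
    and "\<forall>x\<in>set xs. h x \<in> U"
  shows "g (\<Sum>x\<leftarrow>xs. h x) = (\<Sum>x\<leftarrow>xs. g (h x))"
  using assms(5)
  by (induction xs) (simp_all add: assms(1-4) sum_list_closed[where U = U])

context vector_space
begin

lemma scale_sum_list: "scale a (\<Sum>x\<leftarrow>xs. h x) = (\<Sum>x\<leftarrow>xs. scale a (h x))"
  by (rule additive_sum_list) (simp_all add: scale_right_distrib)

lemma sum_list_scale: "scale (\<Sum>x\<leftarrow>xs. k x) v = (\<Sum>x\<leftarrow>xs. scale (k x) v)"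
  by (rule additive_sum_list[where g = "\<lambda>k. scale k v"]) (simp_all add: scale_left_distrib)

lemma functional_iff:
  "Vector_Spaces.linear scale (*) f \<longleftrightarrow>
     (\<forall>x y. f (x + y) = f x + f y) \<and> (\<forall>a x. f (scale a x) = a * f x)"
  by (simp add: Vector_Spaces.linear_iff vector_space_axioms vector_space_mult)

lemma functional_sum_list:
  assumes "Vector_Spaces.linear scale (*) f"
  shows "f (\<Sum>x\<leftarrow>xs. h x) = (\<Sum>x\<leftarrow>xs. f (h x))"
proof (rule additive_sum_list)
  have "f (scale 0 0) = 0 * f 0"
    using assms unfolding functional_iff by blast
  then show "f 0 = 0" by simp
qed (use assms in \<open>simp add: functional_iff\<close>)

lemma subspace_sum_list: "subspace U \<Longrightarrow> \<forall>x\<in>set xs. g x \<in> U \<Longrightarrow> (\<Sum>x\<leftarrow>xs. g x) \<in> U"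
  by (rule sum_list_closed) (auto intro: subspace_0 subspace_add)

lemma functional_extending_basis:
  assumes "independent B"
  obtains f where "Vector_Spaces.linear scale (*) f" and "\<forall>x\<in>B. f x = g x"
proof -
  interpret pair: vector_space_pair scale "(*)"
    by (intro vector_space_pair.intro vector_space_axioms vector_space_mult)
  show thesis
    using pair.linear_independent_extend[OF assms, of g] that by blast
qed

lemma functional_vanish_on_span:
  assumes "Vector_Spaces.linear scale (*) f" and "\<forall>x\<in>X. f x = 0" and "v \<in> span X"
  shows "f v = 0"
proof -
  interpret Vector_Spaces.linear scale "(*)" f by fact
  show ?thesis using eq_0_on_span assms by blast
qed

lemma functional_eq_on_span:
  assumes "Vector_Spaces.linear scale (*) f" and "Vector_Spaces.linear scale (*) g"
    and "\<forall>x\<in>X. f x = g x" and "v \<in> span X"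
  shows "f v = g v"
proof -
  have "Vector_Spaces.linear scale (*) (\<lambda>x. f x - g x)"
    using assms(1,2) by (simp add: functional_iff algebra_simps)
  from functional_vanish_on_span[OF this _ assms(4)] assms(3) show ?thesis by simp
qed

lemma functional_separates:
  assumes "subspace U" and "c \<notin> U"
  obtains f where "Vector_Spaces.linear scale (*) f" and "\<forall>u\<in>U. f u = 0" and "f c \<noteq> 0"
proof -
  obtain B where B: "B \<subseteq> U" "independent B" "U \<subseteq> span B"
    using maximal_independent_subset by blast
  have "c \<notin> span B"
    using assms B(1) span_minimal by blast
  then have "independent (insert c B)"
    using B(2) independent_insertI by blast
  then obtain f where f: "Vector_Spaces.linear scale (*) f"
    and fB: "\<forall>x\<in>insert c B. f x = (if x = c then 1 else 0)"
    by (rule functional_extending_basis)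
  have "\<forall>b\<in>B. f b = 0"
    using fB assms(2) B(1) by auto
  then have "\<forall>u\<in>U. f u = 0"
    using functional_vanish_on_span[OF f] B(3) by blast
  then show thesis
    using f fB that by simp
qed

lemma eq_if_functionals_eq:
  assumes "\<And>f. Vector_Spaces.linear scale (*) f \<Longrightarrow> f u = f v"
  shows "u = v"
proof (rule ccontr)
  assume "u \<noteq> v"
  then have "u - v \<notin> {0}" by simp
  then obtain f where f: "Vector_Spaces.linear scale (*) f" and "f (u - v) \<noteq> 0"
    using functional_separates[OF subspace_single_0] by blast
  moreover have "f (u - v + v) = f (u - v) + f v"
    using f unfolding functional_iff by blast
  ultimately show False
    using assms[OF f] by simp
qed

text \<open>
  A basis of \<open>E\<close> extended within \<open>A \<union> E\<close> acquires new members from \<open>A\<close> only; they span \<open>A\<close>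
  because the sum of \<open>A\<close> and \<open>E\<close> is direct. Hence values can be prescribed on both parts.
\<close>

lemma functional_glued:
  assumes A: "subspace A" and E: "subspace E" and disj: "A \<inter> E = {0}"
    and g: "Vector_Spaces.linear scale (*) g"
  obtains f where "Vector_Spaces.linear scale (*) f"
    and "\<forall>a\<in>A. f a = g a" and "\<forall>e\<in>E. f e = 0"
proof -
  obtain BE where BE: "BE \<subseteq> E" "independent BE" "E \<subseteq> span BE"
    using maximal_independent_subset by blast
  obtain B where B: "BE \<subseteq> B" "B \<subseteq> A \<union> E" "independent B" "A \<union> E \<subseteq> span B"
    using maximal_independent_subset_extend[of BE "A \<union> E"] BE by blast
  define BA where "BA = B - BE"
  have "b \<notin> E" if "b \<in> BA" for b
  proof
    assume "b \<in> E"
    then have "b \<in> span (B - {b})"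
      using BE(3) B(1) that span_mono[of BE "B - {b}"] by (auto simp: BA_def)
    then show False
      using B(3) that by (auto simp: dependent_def BA_def)
  qed
  then have BA: "BA \<subseteq> A"
    using B(2) by (auto simp: BA_def)
  obtain f where f: "Vector_Spaces.linear scale (*) f"
    and fB: "\<forall>x\<in>B. f x = (if x \<in> BE then 0 else g x)"
    by (rule functional_extending_basis[OF B(3), of "\<lambda>x. if x \<in> BE then 0 else g x"])
  have fE: "\<forall>e\<in>E. f e = 0"
  proof
    fix e assume "e \<in> E"
    then have "e \<in> span BE"
      using BE(3) by blast
    moreover have "\<forall>x\<in>BE. f x = 0"
      using fB B(1) by auto
    ultimately show "f e = 0"
      using functional_vanish_on_span[OF f] by blast
  qed
  have "f a = g a" if a: "a \<in> A" for a
  proof -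
    have "a \<in> span (BA \<union> BE)"
      using a B(1,4) by (auto simp: BA_def Un_absorb2)
    then obtain x y where xy: "a = x + y" "x \<in> span BA" "y \<in> span BE"
      unfolding span_Un by blast
    have x: "x \<in> A" and y: "y \<in> E"
      using xy BA BE(1) A E span_minimal by blast+
    have "y = a - x"
      using xy(1) by simp
    then have "y \<in> A \<inter> E"
      using a x y A by (simp add: subspace_diff)
    then have "a \<in> span BA"
      using xy disj by auto
    moreover have "\<forall>x\<in>BA. f x = g x"
      using fB by (auto simp: BA_def)
    ultimately show ?thesis
      using functional_eq_on_span[OF f g] by blast
  qed
  then show thesis
    using that f fE by blast
qed

text \<open>
  The expansion in a finite basis, with coordinates that are functionals on the whole space. It
  produces both the normal forms of tensors and the finite expansions that make a module rational.
\<close>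

lemma finite_coordinates:
  assumes "finite X"
  obtains bs \<beta> where "\<forall>b. Vector_Spaces.linear scale (*) (\<beta> b)"
    and "\<forall>v\<in>span X. v = (\<Sum>b\<leftarrow>bs. scale (\<beta> b v) b)"
proof -
  obtain B where B: "B \<subseteq> X" "independent B" "X \<subseteq> span B"
    using maximal_independent_subset by blast
  have "finite B"
    using assms B(1) finite_subset by blast
  then obtain bs where bs: "set bs = B" "distinct bs"
    using finite_distinct_list by blast
  have "\<exists>f. Vector_Spaces.linear scale (*) f \<and> (\<forall>x\<in>B. f x = (if x = b then 1 else 0))" for b
    by (rule functional_extending_basis[OF B(2), of "\<lambda>x. if x = b then 1 else 0"]) blast
  then obtain \<beta> where \<beta>: "\<And>b. Vector_Spaces.linear scale (*) (\<beta> b)"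
    and \<beta>B: "\<And>b x. x \<in> B \<Longrightarrow> \<beta> b x = (if x = b then 1 else 0)"
    by metis
  have span: "span X = span B"
    using B by (metis span_eq span_superset subset_trans)
  have "v = (\<Sum>b\<in>B. scale (\<beta> b v) b)" if v: "v \<in> span B" for v
    using v
  proof (induction rule: span_induct_alt)
    case base
    have "\<beta> b 0 = 0" for b
      using functional_vanish_on_span[OF \<beta>, of "{}"] by (simp add: span_zero)
    then show ?case by simp
  next
    case (step c x y)
    have "(\<Sum>b\<in>B. scale (\<beta> b x) b) = (\<Sum>b\<in>B. if b = x then x else 0)"
      by (rule sum.cong) (use step(1) \<beta>B in auto)
    also have "\<dots> = x"
      using step(1) \<open>finite B\<close> by simp
    finally have x: "(\<Sum>b\<in>B. scale (\<beta> b x) b) = x" .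
    have "\<beta> b (scale c x + y) = c * \<beta> b x + \<beta> b y" for b
      using \<beta>[of b] by (simp add: functional_iff)
    then have "(\<Sum>b\<in>B. scale (\<beta> b (scale c x + y)) b)
        = scale c (\<Sum>b\<in>B. scale (\<beta> b x) b) + (\<Sum>b\<in>B. scale (\<beta> b y) b)"
      by (simp add: scale_left_distrib sum.distrib scale_sum_right)
    then show ?case
      using x step.IH by simp
  qed
  then have "\<forall>v\<in>span X. v = (\<Sum>b\<leftarrow>bs. scale (\<beta> b v) b)"
    using bs span by (simp add: sum_list_distinct_conv_sum_set)
  then show thesis
    using that[of \<beta> bs] \<beta> by blast
qed

end

section \<open>Tensors and their contractions with functionals\<close>

lemma sum_cong_invariant:
  fixes \<phi> :: "'x \<Rightarrow> 'y::ab_group_add"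
  assumes "sum_cong R s t"
    and "\<And>s t. R s t \<Longrightarrow> sum_list (map \<phi> s) = sum_list (map \<phi> t)"
  shows "sum_list (map \<phi> s) = sum_list (map \<phi> t)"
  using assms(1) by induction (auto simp: assms(2) add.commute)

lemma sum_cong_map:
  assumes "sum_cong R s t" and "\<And>s t. R s t \<Longrightarrow> sum_cong R' (map f s) (map f t)"
  shows "sum_cong R' (map f s) (map f t)"
  using assms(1)
  by induction (auto simp: assms(2) intro: sum_cong.refl sum_cong.sym sum_cong.trans sum_cong.append
      sum_cong.commute)

lemma sum_cong_concat:
  assumes "\<And>b. b \<in> set bs \<Longrightarrow> sum_cong R (F b) (G b)"
  shows "sum_cong R (concat (map F bs)) (concat (map G bs))"
  using assms by (induction bs) (auto intro: sum_cong.refl sum_cong.append)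

text \<open>
  The congruence permits exchanging neighbouring blocks, so two families of sums over the same
  places can be merged place by place.
\<close>

lemma sum_cong_interleave:
  "sum_cong R (concat (map F bs) @ concat (map G bs)) (concat (map (\<lambda>b. F b @ G b) bs))"
proof (induction bs)
  case Nil
  show ?case by (simp add: sum_cong.refl)
next
  case (Cons b bs)
  let ?F = "concat (map F bs)" and ?G = "concat (map G bs)"
  have "sum_cong R (F b @ ((?F @ G b) @ ?G)) (F b @ ((G b @ ?F) @ ?G))"
    by (intro sum_cong.append sum_cong.refl sum_cong.commute)
  moreover have "sum_cong R ((F b @ G b) @ (?F @ ?G))
      ((F b @ G b) @ concat (map (\<lambda>b. F b @ G b) bs))"
    by (intro sum_cong.append sum_cong.refl Cons.IH)
  ultimately show ?case
    by (auto intro: sum_cong.trans)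
qed

text \<open>
  If every term of a formal sum can be spread over the places \<open>bs\<close>, the contributions of all terms
  can be collected place by place. This is what brings a tensor into normal form.
\<close>

lemma sum_cong_collect:
  assumes "\<And>l. l \<in> set s \<Longrightarrow> sum_cong R [l] (map (\<lambda>b. h b l) bs)"
  shows "sum_cong R s (concat (map (\<lambda>b. map (h b) s) bs))"
  using assms
proof (induction s)
  case Nil
  show ?case by (induction bs) (simp_all add: sum_cong.refl)
next
  case (Cons l s)
  have "sum_cong R ([l] @ s)
      (concat (map (\<lambda>b. [h b l]) bs) @ concat (map (\<lambda>b. map (h b) s) bs))"
  proof (rule sum_cong.append)
    show "sum_cong R [l] (concat (map (\<lambda>b. [h b l]) bs))"
      using Cons.prems[of l] by (simp add: concat_map_singleton)
  qed (use Cons in auto)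
  moreover have "sum_cong R \<dots> (concat (map (\<lambda>b. [h b l] @ map (h b) s) bs))"
    by (rule sum_cong_interleave)
  ultimately have "sum_cong R ([l] @ s) (concat (map (\<lambda>b. [h b l] @ map (h b) s) bs))"
    by (rule sum_cong.trans)
  then show ?case by simp
qed

lemma tensor_eq_refl: "tensor_eq sA sB s s"
  by (simp add: tensor_eq_def sum_cong.refl)

lemma tensor_eq_sym: "tensor_eq sA sB s t \<Longrightarrow> tensor_eq sA sB t s"
  by (simp add: tensor_eq_def sum_cong.sym)

lemma tensor_eq_trans: "tensor_eq sA sB s t \<Longrightarrow> tensor_eq sA sB t u \<Longrightarrow> tensor_eq sA sB s u"
  unfolding tensor_eq_def by (rule sum_cong.trans)

lemma tensor_eq_base: "bilinear_rel sA sB s t \<Longrightarrow> tensor_eq sA sB s t"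
  by (simp add: tensor_eq_def sum_cong.base)

lemma tensor_eq_append:
  "tensor_eq sA sB s s' \<Longrightarrow> tensor_eq sA sB t t' \<Longrightarrow> tensor_eq sA sB (s @ t) (s' @ t')"
  unfolding tensor_eq_def by (rule sum_cong.append)

lemma tensor_eq_zero_right:
  assumes "vector_space sA" and "vector_space sB"
  shows "tensor_eq sA sB [(x, 0)] []"
proof -
  interpret A: vector_space sA by fact
  interpret B: vector_space sB by fact
  have "tensor_eq sA sB [(0, 0)] [(x, 0)]"
    using tensor_eq_base[OF bilinear_rel.scale[of sA sB 0 x 0]] by simp
  moreover have "tensor_eq sA sB [(0, 0)] []"
    by (intro tensor_eq_base bilinear_rel.zero)
  ultimately show ?thesis
    using tensor_eq_sym tensor_eq_trans by blast
qed

lemma tensor_eq_sum_left: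
  "tensor_eq sA sB [((\<Sum>b\<leftarrow>bs. g b), y)] (map (\<lambda>b. (g b, y)) bs)"
proof (induction bs)
  case Nil
  show ?case by (simp add: tensor_eq_base bilinear_rel.zero)
next
  case (Cons b bs)
  have "tensor_eq sA sB [(g b + (\<Sum>b\<leftarrow>bs. g b), y)] ([(g b, y)] @ [((\<Sum>b\<leftarrow>bs. g b), y)])"
    using tensor_eq_base[OF bilinear_rel.add1] by simp
  moreover have "tensor_eq sA sB ([(g b, y)] @ [((\<Sum>b\<leftarrow>bs. g b), y)])
      ([(g b, y)] @ map (\<lambda>b. (g b, y)) bs)"
    by (intro tensor_eq_append tensor_eq_refl Cons.IH)
  ultimately show ?case
    by (auto intro: tensor_eq_trans)
qed

lemma tensor_eq_sum_right:
  assumes "vector_space sA" and "vector_space sB"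
  shows "tensor_eq sA sB (map (\<lambda>l. (x, g l)) s) [(x, (\<Sum>l\<leftarrow>s. g l))]"
proof (induction s)
  case Nil
  show ?case using tensor_eq_zero_right[OF assms] by (simp add: tensor_eq_sym)
next
  case (Cons l s)
  have "tensor_eq sA sB ([(x, g l)] @ map (\<lambda>l. (x, g l)) s) ([(x, g l)] @ [(x, (\<Sum>l\<leftarrow>s. g l))])"
    by (intro tensor_eq_append tensor_eq_refl Cons.IH)
  moreover have "tensor_eq sA sB ([(x, g l)] @ [(x, (\<Sum>l\<leftarrow>s. g l))]) [(x, g l + (\<Sum>l\<leftarrow>s. g l))]"
    using tensor_eq_sym[OF tensor_eq_base[OF bilinear_rel.add2]] by simp
  ultimately show ?case
    by (auto intro: tensor_eq_trans)
qed

lemma tensor_eq_sliced: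
  assumes "tensor_eq sA sB s t" and "vector_space sA" and "vector_space sB"
    and "Vector_Spaces.linear sA (*) f"
  shows "(\<Sum>(x, y)\<leftarrow>s. sB (f x) y) = (\<Sum>(x, y)\<leftarrow>t. sB (f x) y)"
proof -
  interpret A: vector_space sA by fact
  interpret B: vector_space sB by fact
  have f: "f (x + y) = f x + f y" "f (sA a x) = a * f x" for x y a
    using assms(4) A.functional_iff by blast+
  have "f 0 = 0"
    using f(2)[of 0 0] by simp
  then show ?thesis
    using assms(1) unfolding tensor_eq_def
    by (elim sum_cong_invariant, elim bilinear_rel.cases)
      (simp_all add: f B.scale_left_distrib B.scale_right_distrib B.scale_left_commute mult.commute)
qed

text \<open>
  Conversely the contractions determine the tensor: writing the first factors in terms of finitely
  many vectors \<open>b\<close> turns a sum into \<open>\<Sum>\<^sub>b b \<otimes> u\<^sub>b\<close>, where \<open>u\<^sub>b\<close> is its contraction with the coordinate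
  functional of \<open>b\<close>.
\<close>

lemma tensor_eq_normal_form:
  assumes A: "vector_space sA" and B: "vector_space sB"
    and exp: "\<forall>(x, y)\<in>set s. x = (\<Sum>b\<leftarrow>bs. sA (\<beta> b x) b)"
  shows "tensor_eq sA sB s (map (\<lambda>b. (b, (\<Sum>(x, y)\<leftarrow>s. sB (\<beta> b x) y))) bs)"
proof -
  define h where "h = (\<lambda>b (x, y). (b, sB (\<beta> b x) y))"
  have "sum_cong (bilinear_rel sA sB) [l] (map (\<lambda>b. h b l) bs)" if "l \<in> set s" for l
  proof -
    obtain x y where l: "l = (x, y)" by fastforce
    have "tensor_eq sA sB [((\<Sum>b\<leftarrow>bs. sA (\<beta> b x) b), y)] (map (\<lambda>b. (sA (\<beta> b x) b, y)) bs)"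
      by (rule tensor_eq_sum_left)
    moreover have "(\<Sum>b\<leftarrow>bs. sA (\<beta> b x) b) = x"
      using exp that l by force
    moreover have "tensor_eq sA sB (concat (map (\<lambda>b. [(sA (\<beta> b x) b, y)]) bs))
        (concat (map (\<lambda>b. [(b, sB (\<beta> b x) y)]) bs))"
      unfolding tensor_eq_def by (intro sum_cong_concat sum_cong.base bilinear_rel.scale)
    ultimately have "tensor_eq sA sB [l] (map (\<lambda>b. h b l) bs)"
      by (auto simp: h_def l concat_map_singleton intro: tensor_eq_trans)
    then show ?thesis by (simp add: tensor_eq_def)
  qed
  then have 1: "tensor_eq sA sB s (concat (map (\<lambda>b. map (h b) s) bs))"
    unfolding tensor_eq_def by (rule sum_cong_collect)
  have "tensor_eq sA sB (map (h b) s) [(b, (\<Sum>(x, y)\<leftarrow>s. sB (\<beta> b x) y))]" for b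
    using tensor_eq_sum_right[OF A B, of b "\<lambda>(x, y). sB (\<beta> b x) y" s]
    by (simp add: h_def case_prod_unfold)
  then have "tensor_eq sA sB (concat (map (\<lambda>b. map (h b) s) bs))
      (concat (map (\<lambda>b. [(b, (\<Sum>(x, y)\<leftarrow>s. sB (\<beta> b x) y))]) bs))"
    unfolding tensor_eq_def by (intro sum_cong_concat)
  with 1 show ?thesis
    by (auto simp: concat_map_singleton intro: tensor_eq_trans)
qed

lemma tensor_eqI:
  assumes A: "vector_space sA" and B: "vector_space sB"
    and eq: "\<And>f. Vector_Spaces.linear sA (*) f \<Longrightarrow>
      (\<Sum>(x, y)\<leftarrow>s. sB (f x) y) = (\<Sum>(x, y)\<leftarrow>t. sB (f x) y)"
  shows "tensor_eq sA sB s t"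
proof -
  interpret A: vector_space sA by fact
  let ?X = "fst ` (set s \<union> set t)"
  obtain bs \<beta> where \<beta>: "\<forall>b. Vector_Spaces.linear sA (*) (\<beta> b)"
    and exp: "\<forall>v\<in>A.span ?X. v = (\<Sum>b\<leftarrow>bs. sA (\<beta> b v) b)"
    by (rule A.finite_coordinates[of ?X]) simp_all
  have exp': "v = (\<Sum>b\<leftarrow>bs. sA (\<beta> b v) b)" if "v \<in> ?X" for v
    using exp A.span_base[OF that] by blast
  have "\<forall>(x, y)\<in>set s. x = (\<Sum>b\<leftarrow>bs. sA (\<beta> b x) b)" "\<forall>(x, y)\<in>set t. x = (\<Sum>b\<leftarrow>bs. sA (\<beta> b x) b)"
    using exp' by force+
  note normal = this[THEN tensor_eq_normal_form[OF A B]]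
  have slices: "(\<Sum>(x, y)\<leftarrow>s. sB (\<beta> b x) y) = (\<Sum>(x, y)\<leftarrow>t. sB (\<beta> b x) y)" for b
    using \<beta> eq by blast
  show ?thesis
    by (rule tensor_eq_trans[OF normal(1)[unfolded slices] tensor_eq_sym[OF normal(2)]])
qed

lemma tensor_eq_swap:
  assumes A: "vector_space sA" and B: "vector_space sB" and "tensor_eq sA sB s t"
  shows "tensor_eq sB sA (map (\<lambda>(x, y). (y, x)) s) (map (\<lambda>(x, y). (y, x)) t)"
  unfolding tensor_eq_def
proof (rule sum_cong_map[OF assms(3)[unfolded tensor_eq_def]])
  fix s t assume "bilinear_rel sA sB s t"
  then have "tensor_eq sB sA (map (\<lambda>(x, y). (y, x)) s) (map (\<lambda>(x, y). (y, x)) t)"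
  proof cases
    case (scale a x y)
    have "tensor_eq sB sA [(sB a y, x)] [(y, sA a x)]"
      by (intro tensor_eq_base bilinear_rel.scale)
    then show ?thesis
      using scale by (simp add: tensor_eq_sym)
  qed (simp_all add: tensor_eq_zero_right[OF B A] tensor_eq_base bilinear_rel.intros)
  then show "sum_cong (bilinear_rel sB sA) (map (\<lambda>(x, y). (y, x)) s) (map (\<lambda>(x, y). (y, x)) t)"
    by (simp add: tensor_eq_def)
qed

lemma tensor_eqI_right:
  assumes A: "vector_space sA" and B: "vector_space sB"
    and eq: "\<And>f. Vector_Spaces.linear sB (*) f \<Longrightarrow>
      (\<Sum>(x, y)\<leftarrow>s. sA (f y) x) = (\<Sum>(x, y)\<leftarrow>t. sA (f y) x)"
  shows "tensor_eq sA sB s t"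
proof -
  let ?swap = "map (\<lambda>(x, y). (y, x))"
  have "tensor_eq sB sA (?swap s) (?swap t)"
  proof (rule tensor_eqI[OF B A])
    fix f assume "Vector_Spaces.linear sB (*) f"
    from eq[OF this]
    show "(\<Sum>(x, y)\<leftarrow>?swap s. sA (f x) y) = (\<Sum>(x, y)\<leftarrow>?swap t. sA (f x) y)"
      by (simp add: case_prod_unfold comp_def)
  qed
  from tensor_eq_swap[OF B A this] show ?thesis
    by (simp add: case_prod_unfold comp_def)
qed

lemma tensor3_eq_sliced:
  assumes "tensor3_eq sA sB sD s t"
    and A: "vector_space sA" and B: "vector_space sB" and D: "vector_space sD"
    and E: "vector_space sE"
    and \<phi>: "\<And>x y z z'. \<phi> x y (z + z') = (\<phi> x y z + \<phi> x y z' :: 'e::ab_group_add)"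
      "\<And>x y y' z. \<phi> x (y + y') z = \<phi> x y z + \<phi> x y' z"
      "\<And>x x' y z. \<phi> (x + x') y z = \<phi> x y z + \<phi> x' y z"
      "\<And>a x y z. \<phi> (sA a x) y z = sE a (\<phi> x y z)"
      "\<And>a x y z. \<phi> x (sB a y) z = sE a (\<phi> x y z)"
      "\<And>a x y z. \<phi> x y (sD a z) = sE a (\<phi> x y z)"
  shows "(\<Sum>(x, y, z)\<leftarrow>s. \<phi> x y z) = (\<Sum>(x, y, z)\<leftarrow>t. \<phi> x y z)"
proof -
  have "\<phi> (0 + 0) y z = \<phi> 0 y z + \<phi> 0 y z" for y z
    by (rule \<phi>)
  then have "\<phi> 0 y z = 0" for y z by simp
  then show ?thesis
    using assms(1) unfolding tensor3_eq_def
    by (elim sum_cong_invariant, elim trilinear_rel.cases) (simp_all add: \<phi>)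
qed

lemma tensor3_eq_append:
  "tensor3_eq sA sB sD s s' \<Longrightarrow> tensor3_eq sA sB sD t t' \<Longrightarrow>
    tensor3_eq sA sB sD (s @ t) (s' @ t')"
  unfolding tensor3_eq_def by (rule sum_cong.append)

lemma tensor3_eq_pair_right:
  assumes "tensor_eq sA sB s t"
  shows "tensor3_eq sA sB sD (map (\<lambda>(x, y). (x, y, z)) s) (map (\<lambda>(x, y). (x, y, z)) t)"
  unfolding tensor3_eq_def
  by (rule sum_cong_map[OF assms[unfolded tensor_eq_def]], elim bilinear_rel.cases)
    (auto intro: sum_cong.base trilinear_rel.intros)

lemma tensor3_eq_sum_last:
  assumes A: "vector_space sA" and B: "vector_space sB" and D: "vector_space sD"
  shows "tensor3_eq sA sB sD [(x, y, (\<Sum>b\<leftarrow>bs. sD (g b) b))] (map (\<lambda>b. (x, sB (g b) y, b)) bs)"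
proof (induction bs)
  case Nil
  interpret B: vector_space sB by fact
  interpret D: vector_space sD by fact
  have "tensor3_eq sA sB sD [(x, sB 0 y, 0)] [(x, y, sD 0 0)]"
    unfolding tensor3_eq_def by (intro sum_cong.base trilinear_rel.scale23)
  moreover have "tensor3_eq sA sB sD [(x, sB 0 y, 0)] []"
    using tensor3_eq_pair_right[OF tensor_eq_zero_right[OF A B], of sD 0 x] by simp
  ultimately show ?case
    unfolding tensor3_eq_def by simp (meson sum_cong.sym sum_cong.trans)
next
  case (Cons b bs)
  let ?z = "\<Sum>b\<leftarrow>bs. sD (g b) b"
  have "tensor3_eq sA sB sD [(x, y, sD (g b) b + ?z)] ([(x, y, sD (g b) b)] @ [(x, y, ?z)])"
    using sum_cong.base[of "trilinear_rel sA sB sD", OF trilinear_rel.add3]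
    by (simp add: tensor3_eq_def)
  moreover have "tensor3_eq sA sB sD ([(x, y, sD (g b) b)] @ [(x, y, ?z)])
      ([(x, sB (g b) y, b)] @ map (\<lambda>b. (x, sB (g b) y, b)) bs)"
    by (intro tensor3_eq_append Cons.IH)
      (auto simp: tensor3_eq_def intro: sum_cong.sym sum_cong.base trilinear_rel.scale23)
  ultimately show ?case
    unfolding tensor3_eq_def by (auto intro: sum_cong.trans)
qed

text \<open>
  With three factors, expanding the last one reduces the comparison of \<open>\<Sum> x \<otimes> y \<otimes> z\<close> to that of
  finitely many tensors with two factors.
\<close>

lemma tensor3_eqI:
  fixes sA :: "'k::field \<Rightarrow> 'a::ab_group_add \<Rightarrow> 'a" and sB :: "'k \<Rightarrow> 'b::ab_group_add \<Rightarrow> 'b"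
    and sD :: "'k \<Rightarrow> 'd::ab_group_add \<Rightarrow> 'd"
  assumes A: "vector_space sA" and B: "vector_space sB" and D: "vector_space sD"
    and eq: "\<And>f g. Vector_Spaces.linear sB (*) f \<Longrightarrow> Vector_Spaces.linear sD (*) g \<Longrightarrow>
      (\<Sum>(x, y, z)\<leftarrow>s. sA (f y * g z) x) = (\<Sum>(x, y, z)\<leftarrow>t. sA (f y * g z) x)"
  shows "tensor3_eq sA sB sD s t"
proof -
  interpret B: vector_space sB by fact
  interpret D: vector_space sD by fact
  let ?Z = "(\<lambda>(x, y, z). z) ` (set s \<union> set t)"
  obtain bs \<beta> where \<beta>: "\<forall>b. Vector_Spaces.linear sD (*) (\<beta> b)"
    and exp: "\<forall>v\<in>D.span ?Z. v = (\<Sum>b\<leftarrow>bs. sD (\<beta> b v) b)"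
    by (rule D.finite_coordinates[of ?Z]) simp_all
  have exp': "v = (\<Sum>b\<leftarrow>bs. sD (\<beta> b v) b)" if "v \<in> ?Z" for v
    using exp D.span_base[OF that] by blast
  define slice where "slice = (\<lambda>b. map (\<lambda>(x :: 'a, y, z). (x, sB (\<beta> b z) y)))"
  define tag where "tag = (\<lambda>b. map (\<lambda>(x :: 'a, y :: 'b). (x, y, b :: 'd)))"
  have normal: "tensor3_eq sA sB sD u (concat (map (\<lambda>b. tag b (slice b u)) bs))"
    if u: "set u \<subseteq> set s \<union> set t" for u
  proof -
    have "tensor3_eq sA sB sD u
        (concat (map (\<lambda>b. map (\<lambda>(x, y, z). (x, sB (\<beta> b z) y, b)) u) bs))"
      unfolding tensor3_eq_def
    proof (rule sum_cong_collect)
      fix l assume "l \<in> set u"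
      moreover obtain x y z where l: "l = (x, y, z)" by (metis prod_cases3)
      ultimately have "z \<in> ?Z" using u by force
      from exp'[OF this] tensor3_eq_sum_last[OF A B D, of x y "\<lambda>b. \<beta> b z" bs]
      show "sum_cong (trilinear_rel sA sB sD) [l]
          (map (\<lambda>b. (case l of (x, y, z) \<Rightarrow> (x, sB (\<beta> b z) y, b))) bs)"
        by (simp add: l tensor3_eq_def)
    qed
    then show ?thesis
      by (simp add: tag_def slice_def case_prod_unfold comp_def)
  qed
  have "tensor_eq sA sB (slice b s) (slice b t)" for b
  proof (rule tensor_eqI_right[OF A B])
    fix f assume f: "Vector_Spaces.linear sB (*) f"
    have "f (sB a y) = f y * a" for a y
      using f by (simp add: B.functional_iff)
    with eq[OF f, of "\<beta> b"] \<beta>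
    show "(\<Sum>(x, y)\<leftarrow>slice b s. sA (f y) x) = (\<Sum>(x, y)\<leftarrow>slice b t. sA (f y) x)"
      by (simp add: slice_def case_prod_unfold comp_def)
  qed
  then have "tensor3_eq sA sB sD (tag b (slice b s)) (tag b (slice b t))" for b
    unfolding tag_def by (rule tensor3_eq_pair_right)
  then have "tensor3_eq sA sB sD (concat (map (\<lambda>b. tag b (slice b s)) bs))
      (concat (map (\<lambda>b. tag b (slice b t)) bs))"
    unfolding tensor3_eq_def by (intro sum_cong_concat)
  with normal[of s] normal[of t] show ?thesis
    unfolding tensor3_eq_def by (meson Un_upper1 Un_upper2 sum_cong.sym sum_cong.trans)
qed

section \<open>Simple submodules of a module with operators\<close>

text \<open>
  Module theory over an algebra that is given by its set \<open>F\<close> of linear operators. For \<open>F = C\<^sup>*\<close>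
  acting on \<open>C\<close> from the right, the submodules are the left subcomodules.
\<close>

locale operator_module = vector_space scale
  for scale :: "'k::field \<Rightarrow> 'v::ab_group_add \<Rightarrow> 'v" +
  fixes F :: "'f set" and act :: "'f \<Rightarrow> 'v \<Rightarrow> 'v"
  assumes act_add: "f \<in> F \<Longrightarrow> act f (x + y) = act f x + act f y"
    and act_scale: "f \<in> F \<Longrightarrow> act f (scale a x) = scale a (act f x)"
begin

definition submodule :: "'v set \<Rightarrow> bool" where
  "submodule S \<longleftrightarrow> subspace S \<and> (\<forall>f\<in>F. \<forall>s\<in>S. act f s \<in> S)"

definition simple :: "'v set \<Rightarrow> bool" where
  "simple S \<longleftrightarrow> submodule S \<and> S \<noteq> {0} \<and> (\<forall>P\<subseteq>S. submodule P \<longrightarrow> P = {0} \<or> P = S)"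

definition isomorphic :: "'v set \<Rightarrow> 'v set \<Rightarrow> bool" where
  "isomorphic S T \<longleftrightarrow> (\<exists>h. bij_betw h S T \<and> (\<forall>x\<in>S. \<forall>y\<in>S. h (x + y) = h x + h y) \<and>
     (\<forall>a. \<forall>x\<in>S. h (scale a x) = scale a (h x)) \<and> (\<forall>f\<in>F. \<forall>x\<in>S. h (act f x) = act f (h x)))"

lemma act_zero: "f \<in> F \<Longrightarrow> act f 0 = 0"
  using act_scale[of f 0 0] by simp

lemma act_minus: "f \<in> F \<Longrightarrow> act f (- x) = - act f x"
  using act_scale[of f "-1" x] by simp

lemma act_diff: "f \<in> F \<Longrightarrow> act f (x - y) = act f x - act f y"
  using act_add[of f x "- y"] act_minus by simp

lemma submodule_Int: "submodule S \<Longrightarrow> submodule T \<Longrightarrow> submodule (S \<inter> T)"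
  by (auto simp: submodule_def intro: subspace_inter)

lemma submodule_zero: "submodule {0}"
  by (simp add: submodule_def act_zero)

lemma submodule_span:
  assumes "\<forall>f\<in>F. \<forall>x\<in>X. act f x \<in> span X"
  shows "submodule (span X)"
  unfolding submodule_def
proof (intro conjI ballI)
  fix f s assume f: "f \<in> F" and s: "s \<in> span X"
  show "act f s \<in> span X"
    using s
  proof (induction rule: span_induct_alt)
    case base
    show ?case using f by (simp add: act_zero span_zero)
  next
    case (step c x y)
    then show ?case
      using f assms by (simp add: act_add act_scale span_add span_scale)
  qed
qed simp

lemma submodule_span_Union:
  assumes "\<forall>X\<in>\<X>. submodule X"
  shows "submodule (span (\<Union>\<X>))"
proof (rule submodule_span, intro ballI)
  fix f x assume "f \<in> F" "x \<in> \<Union>\<X>"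
  then have "act f x \<in> \<Union>\<X>"
    using assms by (auto simp: submodule_def)
  then show "act f x \<in> span (\<Union>\<X>)" by (rule span_base)
qed

lemma simple_Int:
  assumes "simple S" and "submodule T"
  shows "S \<inter> T = {0} \<or> S \<subseteq> T"
  using assms submodule_Int[of S T] unfolding simple_def by blast

text \<open>
  Schur's lemma for a homomorphism defined on \<open>S\<close> only. The domain is allowed to lie in another
  space, since it is applied both to submodules and to comodules given abstractly.
\<close>

lemma simple_image:
  fixes sN :: "'k \<Rightarrow> 'n::ab_group_add \<Rightarrow> 'n"
  assumes N: "vector_space sN" and S: "module.subspace sN S"
    and closed: "\<forall>f\<in>F. \<forall>x\<in>S. actN f x \<in> S"
    and minimal: "\<forall>P\<subseteq>S. module.subspace sN P \<and> (\<forall>f\<in>F. \<forall>x\<in>P. actN f x \<in> P) \<longrightarrow>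
      P = {0} \<or> P = S"
    and add: "\<And>x y. x \<in> S \<Longrightarrow> y \<in> S \<Longrightarrow> h (x + y) = h x + h y"
    and scale: "\<And>a x. x \<in> S \<Longrightarrow> h (sN a x) = scale a (h x)"
    and equiv: "\<And>f x. f \<in> F \<Longrightarrow> x \<in> S \<Longrightarrow> h (actN f x) = act f (h x)"
    and nonzero: "h ` S \<noteq> {0}"
  shows "inj_on h S \<and> simple (h ` S)"
proof -
  interpret N: vector_space sN by fact
  have h0: "h 0 = 0" using scale[of 0 0] S N.subspace_0 by simp
  have preimage: "{x \<in> S. h x \<in> P} = {0} \<or> {x \<in> S. h x \<in> P} = S" if P: "submodule P" for P
  proof (rule minimal[rule_format], blast, intro conjI ballI)
    have "subspace P" using P by (simp add: submodule_def)
    then show "N.subspace {x \<in> S. h x \<in> P}"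
      using S h0 add scale
      by (intro N.subspaceI)
        (auto simp: N.subspace_0 N.subspace_add N.subspace_scale subspace_0 subspace_add subspace_scale)
    show "actN f x \<in> {x \<in> S. h x \<in> P}" if "f \<in> F" "x \<in> {x \<in> S. h x \<in> P}" for f x
      using that closed equiv P by (auto simp: submodule_def)
  qed
  have "{x \<in> S. h x \<in> {0}} \<noteq> S"
    using nonzero N.subspace_0[OF S] h0 by force
  then have kernel: "{x \<in> S. h x \<in> {0}} = {0}"
    using preimage[OF submodule_zero] by blast
  have "inj_on h S"
  proof (rule inj_onI)
    fix x y assume xy: "x \<in> S" "y \<in> S" "h x = h y"
    have "x - y \<in> S" by (rule N.subspace_diff[OF S xy(1,2)])
    moreover have "h (x - y) = 0"
      using add[OF \<open>x - y \<in> S\<close> xy(2)] xy(3) by simp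
    ultimately have "x - y \<in> {x \<in> S. h x \<in> {0}}" by simp
    then have "x - y = 0" unfolding kernel by simp
    then show "x = y" by simp
  qed
  moreover have "submodule (h ` S)"
    unfolding submodule_def
  proof (intro conjI ballI)
    show "subspace (h ` S)"
    proof (rule subspaceI)
      show "0 \<in> h ` S" using h0 N.subspace_0[OF S] by (metis imageI)
      show "x + y \<in> h ` S" if "x \<in> h ` S" "y \<in> h ` S" for x y
        using that N.subspace_add[OF S] add by (smt (verit) imageE imageI)
      show "scale c x \<in> h ` S" if "x \<in> h ` S" for c x
        using that N.subspace_scale[OF S] scale by (smt (verit) imageE imageI)
    qed
    show "act f x \<in> h ` S" if "f \<in> F" "x \<in> h ` S" for f x
      using that closed equiv by (smt (verit) imageE imageI)
  qed
  moreover have "P = {0} \<or> P = h ` S" if P: "P \<subseteq> h ` S" "submodule P" for P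
  proof -
    have "P = h ` {x \<in> S. h x \<in> P}" using P(1) by blast
    then show ?thesis using preimage[OF P(2)] h0 by force
  qed
  ultimately show ?thesis
    using nonzero unfolding simple_def by blast
qed

text \<open>
  If \<open>T \<subseteq> X + Y\<close> while \<open>T\<close> and \<open>X\<close> meet \<open>Y\<close> trivially, sending \<open>t \<in> T\<close> to its
  \<open>X\<close>-component is well defined and injective; it is onto as \<open>X\<close> is simple.
\<close>

lemma isomorphic_by_projection:
  assumes T: "simple T" and X: "simple X" and Y: "submodule Y"
    and TY: "T \<inter> Y = {0}" and XY: "X \<inter> Y = {0}" and sum: "T \<subseteq> span (X \<union> Y)"
  shows "isomorphic T X"
proof -
  have sub: "subspace T" "subspace X" "subspace Y"
    using T X Y by (auto simp: simple_def submodule_def)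
  have closed: "act f t \<in> T" "act f x \<in> X" "act f y \<in> Y" if "f \<in> F" "t \<in> T" "x \<in> X" "y \<in> Y"
    for f t x y
    using T X Y that by (auto simp: simple_def submodule_def)
  have ex: "\<exists>x\<in>X. t - x \<in> Y" if "t \<in> T" for t
  proof -
    have "t \<in> span (X \<union> Y)" using that sum by blast
    then obtain x y where "t = x + y" "x \<in> X" "y \<in> Y"
      unfolding span_Un span_eq_iff[THEN iffD2, OF sub(2)] span_eq_iff[THEN iffD2, OF sub(3)]
      by blast
    then show ?thesis by (intro bexI[of _ x]) auto
  qed
  then obtain h where hX: "\<And>t. t \<in> T \<Longrightarrow> h t \<in> X" and hY: "\<And>t. t \<in> T \<Longrightarrow> t - h t \<in> Y"
    by metis
  have unique: "h t = x" if t: "t \<in> T" and x: "x \<in> X" "t - x \<in> Y" for t x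
  proof -
    have "(t - x) - (t - h t) \<in> Y"
      by (rule subspace_diff[OF sub(3) x(2) hY[OF t]])
    moreover have "h t - x \<in> X"
      by (rule subspace_diff[OF sub(2) hX[OF t] x(1)])
    ultimately have "h t - x \<in> X \<inter> Y" by simp
    then show ?thesis using XY by simp
  qed
  have add: "h (s + t) = h s + h t" if "s \<in> T" "t \<in> T" for s t
  proof (rule unique)
    have "(s - h s) + (t - h t) \<in> Y"
      by (rule subspace_add[OF sub(3) hY[OF that(1)] hY[OF that(2)]])
    then show "s + t - (h s + h t) \<in> Y" by (simp add: algebra_simps)
  qed (use that hX sub subspace_add in auto)
  have scale: "h (scale a t) = scale a (h t)" if "t \<in> T" for a t
  proof (rule unique)
    have "scale a (t - h t) \<in> Y"
      by (rule subspace_scale[OF sub(3) hY[OF that]])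
    then show "scale a t - scale a (h t) \<in> Y" by (simp add: scale_right_diff_distrib)
  qed (use that hX sub subspace_scale in auto)
  have equiv: "h (act f t) = act f (h t)" if "f \<in> F" "t \<in> T" for f t
  proof (rule unique)
    have "act f (t - h t) \<in> Y"
      using that hY Y by (auto simp: submodule_def)
    then show "act f t - act f (h t) \<in> Y" using that by (simp add: act_diff)
  qed (use that hX T X in \<open>auto simp: simple_def submodule_def\<close>)
  have "h ` T \<noteq> {0}"
  proof
    assume zero: "h ` T = {0}"
    have "t \<in> T \<inter> Y" if "t \<in> T" for t
    proof -
      have "h t = 0" using zero that by blast
      then show ?thesis using hY[OF that] that by simp
    qed
    then show False
      using T TY by (auto simp: simple_def)
  qed
  then have "inj_on h T \<and> simple (h ` T)"
  proof (rule simple_image[OF vector_space_axioms sub(1), where actN = act, rotated -1])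
    show "\<forall>P\<subseteq>T. subspace P \<and> (\<forall>f\<in>F. \<forall>x\<in>P. act f x \<in> P) \<longrightarrow> P = {0} \<or> P = T"
      using T by (simp add: simple_def submodule_def)
  qed (use T add scale equiv in \<open>auto simp: simple_def submodule_def\<close>)
  moreover have "h ` T \<subseteq> X" using hX by blast
  ultimately have "bij_betw h T X"
    using X unfolding simple_def bij_betw_def by blast
  then show ?thesis
    unfolding isomorphic_def using add scale equiv by blast
qed

lemma simple_in_finite_sum:
  assumes "finite \<X>" and T: "simple T" and "\<forall>X\<in>\<X>. simple X" and "T \<subseteq> span (\<Union>\<X>)"
  shows "\<exists>X\<in>\<X>. isomorphic T X"
  using assms(1,3,4)
proof (induction \<X>)
  case empty
  then have "T \<subseteq> {0}" by simp
  moreover have "0 \<in> T" using T by (simp add: simple_def submodule_def subspace_0)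
  ultimately show ?case using T by (auto simp: simple_def)
next
  case (insert X \<X>)
  define Y where "Y = span (\<Union>\<X>)"
  have Y: "submodule Y"
    unfolding Y_def by (rule submodule_span_Union) (use insert.prems in \<open>auto simp: simple_def\<close>)
  have sum: "T \<subseteq> span (X \<union> Y)"
  proof -
    have "X \<union> \<Union>\<X> \<subseteq> X \<union> Y" using span_superset[of "\<Union>\<X>"] by (auto simp: Y_def)
    then have "span (\<Union>(insert X \<X>)) \<subseteq> span (X \<union> Y)" using span_mono by simp
    then show ?thesis using insert.prems by blast
  qed
  show ?case
  proof (cases "T \<subseteq> Y")
    case True
    then show ?thesis using insert unfolding Y_def by auto
  next
    case False
    have "\<not> X \<subseteq> Y"
    proof
      assume "X \<subseteq> Y"
      then have "span (X \<union> Y) = Y" using Y by (simp add: Un_absorb1 submodule_def)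
      then show False using False sum by simp
    qed
    then have "T \<inter> Y = {0}" "X \<inter> Y = {0}"
      using False simple_Int T Y insert.prems by auto
    then show ?thesis
      using isomorphic_by_projection[of T X Y] T Y sum insert.prems by blast
  qed
qed

lemma span_Union_finite_subfamily:
  assumes "v \<in> span (\<Union>\<X>)"
  obtains \<Y> where "finite \<Y>" "\<Y> \<subseteq> \<X>" "v \<in> span (\<Union>\<Y>)"
proof -
  have "\<exists>\<Y>. finite \<Y> \<and> \<Y> \<subseteq> \<X> \<and> v \<in> span (\<Union>\<Y>)"
    using assms
  proof (induction rule: span_induct_alt)
    case base
    show ?case by (intro exI[of _ "{}"]) (simp add: span_zero)
  next
    case (step c x y)
    then obtain \<Y> X where Y: "finite \<Y>" "\<Y> \<subseteq> \<X>" "y \<in> span (\<Union>\<Y>)" and X: "x \<in> X" "X \<in> \<X>"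
      by blast
    have "y \<in> span (\<Union>(insert X \<Y>))"
      using Y(3) span_mono[of "\<Union>\<Y>" "\<Union>(insert X \<Y>)"] by auto
    moreover have "x \<in> span (\<Union>(insert X \<Y>))"
      using X by (auto intro: span_base)
    ultimately have "scale c x + y \<in> span (\<Union>(insert X \<Y>))"
      by (intro span_add span_scale)
    then show ?case using Y X by (intro exI[of _ "insert X \<Y>"]) auto
  qed
  then show thesis using that by blast
qed

text \<open>
  The sum of an arbitrary family reduces to that of a finite one, as a single non-zero element
  already generates \<open>T\<close>.
\<close>

lemma simple_in_sum:
  assumes T: "simple T" and X: "\<forall>X\<in>\<X>. simple X" and "T \<subseteq> span (\<Union>\<X>)"
  shows "\<exists>X\<in>\<X>. isomorphic T X"
proof -
  have "0 \<in> T" using T by (simp add: simple_def submodule_def subspace_0)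
  then obtain t where t: "t \<in> T" "t \<noteq> 0"
    using T by (auto simp: simple_def)
  then obtain \<Y> where Y: "finite \<Y>" "\<Y> \<subseteq> \<X>" "t \<in> span (\<Union>\<Y>)"
    using span_Union_finite_subfamily assms(3) by blast
  have "submodule (span (\<Union>\<Y>))"
    by (rule submodule_span_Union) (use Y X in \<open>auto simp: simple_def\<close>)
  then have "T \<subseteq> span (\<Union>\<Y>)"
    using simple_Int[OF T] t Y(3) by blast
  then show ?thesis
    using simple_in_finite_sum[OF Y(1) T] X Y(2) by blast
qed

text \<open>
  By \<open>simple_in_sum\<close> none of the submodules lies in the sum of the others, so picking one suitable
  vector from each, one after the other, gives an independent set.
\<close>

lemma card_nonisomorphic_simples_le:
  assumes "finite \<X>" and "\<forall>X\<in>\<X>. simple X"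
    and "\<forall>X\<in>\<X>. \<forall>Y\<in>\<X>. isomorphic X Y \<longrightarrow> X = Y"
    and "finite W" and "\<Union>\<X> \<subseteq> span W"
  shows "card \<X> \<le> card W"
proof -
  have "\<exists>B. finite B \<and> independent B \<and> B \<subseteq> \<Union>\<X> \<and> card B = card \<X>"
    using assms(1-3)
  proof (induction \<X>)
    case empty
    show ?case by (intro exI[of _ "{}"]) (simp add: independent_empty)
  next
    case (insert X \<X>)
    then obtain B where B: "finite B" "independent B" "B \<subseteq> \<Union>\<X>" "card B = card \<X>"
      by auto
    have X: "simple X" using insert.prems by blast
    have "\<not> X \<subseteq> span (\<Union>\<X>)"
    proof
      assume "X \<subseteq> span (\<Union>\<X>)"
      then obtain Y where Y: "Y \<in> \<X>" "isomorphic X Y"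
        using simple_in_sum[OF X] insert.prems by blast
      then have "X = Y" using insert.prems by blast
      then show False using Y(1) insert.hyps by blast
    qed
    then obtain x where x: "x \<in> X" "x \<notin> span (\<Union>\<X>)" by blast
    then have "x \<notin> span B" using span_mono[OF B(3)] by blast
    then have "independent (insert x B)" using B(2) independent_insertI by blast
    moreover have "x \<notin> B" using \<open>x \<notin> span B\<close> span_base by blast
    ultimately show ?case
      using B x insert.hyps by (intro exI[of _ "insert x B"]) auto
  qed
  then obtain B where B: "finite B" "independent B" "B \<subseteq> \<Union>\<X>" "card B = card \<X>" by blast
  have "B \<subseteq> span W" using B(3) assms(5) by blast
  then show ?thesis
    using independent_span_bound[OF assms(4) B(2)] B(4) by simp
qed

text \<open>
  The annihilator is an isomorphism invariant that can be compared without choosing isomorphisms.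
\<close>

lemma isomorphic_annihilator:
  assumes "isomorphic S T" and "submodule S" and f: "f \<in> F"
  shows "(\<forall>s\<in>S. act f s = 0) \<longleftrightarrow> (\<forall>t\<in>T. act f t = 0)"
proof -
  obtain h where h: "bij_betw h S T" "\<forall>a. \<forall>x\<in>S. h (scale a x) = scale a (h x)"
    "\<forall>f\<in>F. \<forall>x\<in>S. h (act f x) = act f (h x)"
    using assms(1) unfolding isomorphic_def by blast
  have S0: "0 \<in> S" using assms(2) by (simp add: submodule_def subspace_0)
  have h0: "h 0 = 0" using h(2) S0 by (metis scale_zero_left)
  have T: "T = h ` S" using h(1) by (simp add: bij_betw_def)
  have inj: "h x = 0 \<longleftrightarrow> x = 0" if "x \<in> S" for x
    using h(1) h0 S0 that by (auto simp: bij_betw_def inj_on_def)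
  have "h (act f s) = 0 \<longleftrightarrow> act f s = 0" if "s \<in> S" for s
    using inj assms(2) f that by (auto simp: submodule_def)
  then show ?thesis using h(3) f by (auto simp: T)
qed

text \<open>
  In a submodule inside a finite-dimensional space, a non-zero submodule of least dimension is simple.
\<close>

lemma simple_submodule_exists:
  assumes U: "submodule U" and "U \<noteq> {0}" and W: "finite W" "U \<subseteq> span W"
  obtains X where "simple X" and "X \<subseteq> U"
proof -
  let ?P = "\<lambda>X. submodule X \<and> X \<noteq> {0} \<and> X \<subseteq> U"
  define X where "X = (ARG_MIN dim X. ?P X)"
  have X: "?P X" and least: "\<And>Y. ?P Y \<Longrightarrow> dim X \<le> dim Y"
    using arg_min_nat_lemma[of ?P U dim] assms unfolding X_def by auto
  have "P = X" if P: "P \<subseteq> X" "submodule P" "P \<noteq> {0}" for P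
  proof (rule ccontr)
    assume "P \<noteq> X"
    then obtain x where x: "x \<in> X" "x \<notin> P" using P(1) by blast
    obtain B where B: "B \<subseteq> P" "independent B" "P \<subseteq> span B" "card B = dim P"
      using basis_exists by blast
    have "x \<notin> span B"
      using x(2) B(1) P(2) span_minimal by (metis submodule_def subsetD)
    then have ind: "independent (insert x B)" and "x \<notin> B"
      using B(2) independent_insertI span_base by blast+
    obtain B' where B': "B' \<subseteq> X" "independent B'" "X \<subseteq> span B'" "card B' = dim X"
      using basis_exists by blast
    have "finite B'"
      using independent_span_bound[OF W(1) B'(2)] B'(1) X W(2) by blast
    moreover have "insert x B \<subseteq> span B'" using x(1) B(1) P(1) B'(3) by blast
    ultimately have "finite (insert x B) \<and> card (insert x B) \<le> card B'"
      by (intro independent_span_bound[OF _ ind])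
    then have "dim P < dim X" using \<open>x \<notin> B\<close> B(4) B'(4) by auto
    moreover have "dim X \<le> dim P" using least P X by blast
    ultimately show False by simp
  qed
  then have "simple X" using X unfolding simple_def by blast
  then show thesis using that X by blast
qed

end

section \<open>Comodules as modules over the dual algebra\<close>

text \<open>
  Contracting the coalgebra factor of a left coaction with \<open>f\<close> gives the right action
  \<open>n \<cdot> f = f(n\<^sub>-\<^sub>1) n\<^sub>0\<close> of the dual algebra.
\<close>

definition slice :: "('k::field \<Rightarrow> 'n::ab_group_add \<Rightarrow> 'n) \<Rightarrow> ('n \<Rightarrow> ('c \<times> 'n) list) \<Rightarrow>
    ('c \<Rightarrow> 'k) \<Rightarrow> 'n \<Rightarrow> 'n" where
  "slice sN \<rho> f n = (\<Sum>(x, y)\<leftarrow>\<rho> n. sN (f x) y)"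

context coalgebra
begin

lemma dual_iff:
  "f \<in> dual \<longleftrightarrow> (\<forall>x y. f (x + y) = f x + f y) \<and> (\<forall>a x. f (scale a x) = a * f x)"
  by (simp add: dual_def functional_iff)

lemma dual_add: "f \<in> dual \<Longrightarrow> f (x + y) = f x + f y"
  by (simp add: dual_iff)

lemma dual_scale: "f \<in> dual \<Longrightarrow> f (scale a x) = a * f x"
  by (simp add: dual_iff)

lemma dual_plus: "f \<in> dual \<Longrightarrow> g \<in> dual \<Longrightarrow> (\<lambda>c. f c + g c) \<in> dual"
  by (simp add: dual_iff algebra_simps)

lemma dual_times: "f \<in> dual \<Longrightarrow> (\<lambda>c. a * f c) \<in> dual"
  by (simp add: dual_iff algebra_simps)

lemma dual_const_zero: "(\<lambda>c. 0) \<in> dual"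
  by (simp add: dual_iff)

lemma counit_dual: "\<epsilon> \<in> dual"
  using counit_linear by (simp add: dual_def)

lemma dual_zero: "f \<in> dual \<Longrightarrow> f 0 = 0"
  using dual_iff[of f] by (metis mult_zero_left scale_zero_left)

lemma dual_sum_list: "f \<in> dual \<Longrightarrow> f (\<Sum>x\<leftarrow>xs. h x) = (\<Sum>x\<leftarrow>xs. f (h x))"
  by (simp add: dual_def functional_sum_list)

lemma left_comodule_self: "left_comodule scale UNIV \<Delta>"
  unfolding left_comodule_def
  using vector_space_axioms comult_linear coassoc counit_left by simp

lemma slice_add:
  assumes N: "left_comodule sN N \<rho>" and f: "f \<in> dual" and n: "n \<in> N" "n' \<in> N"
  shows "slice sN \<rho> f (n + n') = slice sN \<rho> f n + slice sN \<rho> f n'"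
proof -
  have V: "vector_space sN" and "tensor_eq scale sN (\<rho> (n + n')) (\<rho> n @ \<rho> n')"
    using N n by (auto simp: left_comodule_def linear_into_tensor_def)
  from tensor_eq_sliced[OF this(2) vector_space_axioms V, of f] f
  show ?thesis by (simp add: slice_def dual_def)
qed

lemma slice_scale:
  assumes N: "left_comodule sN N \<rho>" and f: "f \<in> dual" and n: "n \<in> N"
  shows "slice sN \<rho> f (sN a n) = sN a (slice sN \<rho> f n)"
proof -
  have V: "vector_space sN"
    and eq: "tensor_eq scale sN (\<rho> (sN a n)) (map (\<lambda>(u, v). (scale a u, v)) (\<rho> n))"
    using N n by (auto simp: left_comodule_def linear_into_tensor_def)
  interpret N: vector_space sN by (rule V)
  have "f (scale a u) = a * f u" for u using f by (simp add: dual_iff)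
  then show ?thesis
    using tensor_eq_sliced[OF eq vector_space_axioms V, of f] f
    by (simp add: slice_def dual_def case_prod_unfold comp_def N.scale_sum_list)
qed

lemma slice_closed:
  assumes N: "left_comodule sN N \<rho>" and n: "n \<in> N"
  shows "slice sN \<rho> f n \<in> N"
proof -
  interpret N: vector_space sN using N by (simp add: left_comodule_def)
  have "snd ` set (\<rho> n) \<subseteq> N" "N.subspace N" using N n by (auto simp: left_comodule_def)
  then show ?thesis
    unfolding slice_def by (intro N.subspace_sum_list) (auto simp: N.subspace_scale)
qed

lemma slice_counit: "left_comodule sN N \<rho> \<Longrightarrow> n \<in> N \<Longrightarrow> slice sN \<rho> \<epsilon> n = n"
  by (simp add: left_comodule_def slice_def)

text \<open>
  Coassociativity, contracted with \<open>f \<otimes> g\<close> on the two coalgebra factors.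
\<close>

lemma slice_conv:
  assumes N: "left_comodule sN N \<rho>" and f: "f \<in> dual" and g: "g \<in> dual" and n: "n \<in> N"
  shows "slice sN \<rho> (conv f g) n = slice sN \<rho> g (slice sN \<rho> f n)"
proof -
  have V: "vector_space sN"
    and coas: "tensor3_eq scale scale sN
        [(u, v, y). (x, y) \<leftarrow> \<rho> n, (u, v) \<leftarrow> \<Delta> x] [(x, u, v). (x, y) \<leftarrow> \<rho> n, (u, v) \<leftarrow> \<rho> y]"
    using N n by (auto simp: left_comodule_def)
  interpret N: vector_space sN by (rule V)
  have sub: "N.subspace N" and in_N: "snd ` set (\<rho> n) \<subseteq> N" using N n by (auto simp: left_comodule_def)
  have fg: "f (x + y) = f x + f y" "f (scale a x) = a * f x" "g (x + y) = g x + g y"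
    "g (scale a x) = a * g x" for a x y
    using f g by (auto simp: dual_iff)
  let ?\<phi> = "\<lambda>x y z. sN (f x * g y) z"
  have "(\<Sum>(x, y, z)\<leftarrow>[(u, v, y). (x, y) \<leftarrow> \<rho> n, (u, v) \<leftarrow> \<Delta> x]. ?\<phi> x y z)
      = (\<Sum>(x, y, z)\<leftarrow>[(x, u, v). (x, y) \<leftarrow> \<rho> n, (u, v) \<leftarrow> \<rho> y]. ?\<phi> x y z)"
    by (rule tensor3_eq_sliced[OF coas vector_space_axioms vector_space_axioms V V])
      (simp_all add: fg algebra_simps N.scale_left_distrib N.scale_right_distrib)
  moreover have "(\<Sum>(x, y, z)\<leftarrow>[(u, v, y). (x, y) \<leftarrow> \<rho> n, (u, v) \<leftarrow> \<Delta> x]. ?\<phi> x y z)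
      = slice sN \<rho> (conv f g) n"
    by (simp add: slice_def conv_def case_prod_unfold comp_def sum_list_map_concat N.sum_list_scale)
  moreover have "(\<Sum>(x, y, z)\<leftarrow>[(x, u, v). (x, y) \<leftarrow> \<rho> n, (u, v) \<leftarrow> \<rho> y]. ?\<phi> x y z)
      = (\<Sum>(x, y)\<leftarrow>\<rho> n. sN (f x) (slice sN \<rho> g y))"
    by (simp add: slice_def case_prod_unfold comp_def sum_list_map_concat N.scale_sum_list)
  moreover have "\<dots> = (\<Sum>(x, y)\<leftarrow>\<rho> n. slice sN \<rho> g (sN (f x) y))"
    by (rule arg_cong[where f = sum_list], rule map_cong[OF HOL.refl])
      (use in_N slice_scale[OF N g] in auto)
  moreover have "\<dots> = slice sN \<rho> g (slice sN \<rho> f n)"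
  proof -
    have "slice sN \<rho> g 0 = 0"
      using slice_scale[OF N g N.subspace_0[OF sub], of 0] by simp
    moreover have "\<forall>l\<in>set (\<rho> n). (case l of (x, y) \<Rightarrow> sN (f x) y) \<in> N"
      using in_N sub by (auto simp: N.subspace_scale)
    ultimately show ?thesis
      using additive_on_sum_list[where U = N and g = "slice sN \<rho> g" and xs = "\<rho> n"
          and h = "\<lambda>(x, y). sN (f x) y"] slice_add[OF N g] sub
      by (simp add: slice_def[of sN \<rho> f] N.subspace_0 N.subspace_add case_prod_unfold)
  qed
  ultimately show ?thesis by simp
qed

text \<open>
  If \<open>P\<close> is stable under the action, the normal form of \<open>\<rho> p\<close> has second factors \<open>p \<cdot> \<beta>\<^sub>b\<close> and hence
  is a tensor with all these factors in \<open>P\<close>.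
\<close>

lemma left_subcomodule_iff:
  assumes V: "vector_space sN"
  shows "left_subcomodule sN N \<rho> P \<longleftrightarrow>
    P \<subseteq> N \<and> module.subspace sN P \<and> (\<forall>f\<in>dual. \<forall>p\<in>P. slice sN \<rho> f p \<in> P)"
proof -
  interpret N: vector_space sN by fact
  have "slice sN \<rho> f p \<in> P"
    if "N.subspace P" "f \<in> dual" "snd ` set t \<subseteq> P" "tensor_eq scale sN (\<rho> p) t" for f p t
  proof -
    have "slice sN \<rho> f p = (\<Sum>(x, y)\<leftarrow>t. sN (f x) y)"
      using tensor_eq_sliced[OF that(4) vector_space_axioms V] that(2) by (simp add: slice_def dual_def)
    also have "\<dots> \<in> P"
      using that(1,3) by (intro N.subspace_sum_list) (auto simp: N.subspace_scale)
    finally show ?thesis .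
  qed
  moreover have "\<exists>t. snd ` set t \<subseteq> P \<and> tensor_eq scale sN (\<rho> p) t"
    if P: "\<forall>f\<in>dual. \<forall>p\<in>P. slice sN \<rho> f p \<in> P" and p: "p \<in> P" for p
  proof -
    obtain bs \<beta> where \<beta>: "\<forall>b. Vector_Spaces.linear scale (*) (\<beta> b)"
      and exp: "\<forall>v\<in>span (fst ` set (\<rho> p)). v = (\<Sum>b\<leftarrow>bs. scale (\<beta> b v) b)"
      by (rule finite_coordinates[of "fst ` set (\<rho> p)"]) simp_all
    have "v = (\<Sum>b\<leftarrow>bs. scale (\<beta> b v) b)" if "v \<in> fst ` set (\<rho> p)" for v
      using exp span_base[OF that] by blast
    then have "\<forall>(x, y)\<in>set (\<rho> p). x = (\<Sum>b\<leftarrow>bs. scale (\<beta> b x) b)"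
      by force
    from tensor_eq_normal_form[OF vector_space_axioms V this]
    have "tensor_eq scale sN (\<rho> p) (map (\<lambda>b. (b, slice sN \<rho> (\<beta> b) p)) bs)"
      by (simp add: slice_def)
    moreover have "snd ` set (map (\<lambda>b. (b, slice sN \<rho> (\<beta> b) p)) bs) \<subseteq> P"
      using P p \<beta> by (auto simp: dual_def)
    ultimately show ?thesis by blast
  qed
  ultimately show ?thesis unfolding left_subcomodule_def by blast
qed

abbreviation ract :: "('c \<Rightarrow> 'k) \<Rightarrow> 'c \<Rightarrow> 'c" where
  "ract \<equiv> slice scale \<Delta>"

text \<open>
  The left action \<open>f(c\<^sub>2) c\<^sub>1\<close>. The subspaces of \<open>C\<close> stable under both actions are its subcoalgebras.
\<close>

definition lact :: "('c \<Rightarrow> 'k) \<Rightarrow> 'c \<Rightarrow> 'c" where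
  "lact f c = (\<Sum>(x, y)\<leftarrow>\<Delta> c. scale (f y) x)"

sublocale right: operator_module scale dual ract
  by unfold_locales (simp_all add: slice_add[OF left_comodule_self] slice_scale[OF left_comodule_self])

lemma simple_left_subcomodule_self_iff:
  "simple_left_subcomodule scale UNIV \<Delta> S \<longleftrightarrow> right.simple S"
  unfolding simple_left_subcomodule_def right.simple_def right.submodule_def
  by (simp add: left_subcomodule_iff vector_space_axioms)

lemma coradical_eq: "coradical = span (\<Union>{S. right.simple S})"
  by (simp add: coradical_def simple_left_subcomodule_self_iff)

text \<open>
  Applying a functional turns both actions into the convolution product. As functionals separate
  points, identities can be passed back and forth between \<open>C\<close> and its dual algebra.
\<close>

lemma apply_ract: "g \<in> dual \<Longrightarrow> g (ract f c) = conv f g c"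
  by (simp add: slice_def conv_def case_prod_unfold dual_sum_list dual_iff)

lemma apply_lact: "f \<in> dual \<Longrightarrow> f (lact g c) = conv f g c"
  by (simp add: lact_def conv_def case_prod_unfold dual_sum_list dual_iff mult.commute)

lemma conv_dual: "f \<in> dual \<Longrightarrow> g \<in> dual \<Longrightarrow> conv f g \<in> dual"
  by (simp add: dual_iff[of "conv f g"] flip: apply_ract)
    (simp add: right.act_add right.act_scale dual_iff[of g])

lemma ract_conv: "f \<in> dual \<Longrightarrow> g \<in> dual \<Longrightarrow> ract (conv f g) c = ract g (ract f c)"
  by (rule slice_conv[OF left_comodule_self]) simp_all

lemma ract_counit: "ract \<epsilon> c = c"
  by (rule slice_counit[OF left_comodule_self]) simp

lemma lact_counit: "lact \<epsilon> c = c"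
  using counit_right by (simp add: lact_def)

lemma conv_assoc:
  "f \<in> dual \<Longrightarrow> g \<in> dual \<Longrightarrow> h \<in> dual \<Longrightarrow> conv (conv f g) h = conv f (conv g h)"
  by (rule ext) (simp add: conv_dual ract_conv flip: apply_ract)

lemma conv_counit_left: "f \<in> dual \<Longrightarrow> conv \<epsilon> f = f"
  by (rule ext) (simp add: ract_counit flip: apply_ract)

lemma conv_counit_right: "f \<in> dual \<Longrightarrow> conv f \<epsilon> = f"
  by (rule ext) (simp add: lact_counit flip: apply_lact)

lemma eq_if_dual_eq: "(\<And>f. f \<in> dual \<Longrightarrow> f u = f v) \<Longrightarrow> u = v"
  by (rule eq_if_functionals_eq) (simp add: dual_def)

lemma lact_add: "g \<in> dual \<Longrightarrow> lact g (x + y) = lact g x + lact g y"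
  by (rule eq_if_dual_eq) (metis apply_lact conv_dual dual_iff)

lemma lact_scale: "g \<in> dual \<Longrightarrow> lact g (scale a x) = scale a (lact g x)"
  by (rule eq_if_dual_eq) (metis apply_lact conv_dual dual_iff)

text \<open>The two actions commute, so \<open>lact g\<close> is an endomorphism of the right module.\<close>

lemma lact_ract:
  assumes "f \<in> dual" and "g \<in> dual"
  shows "lact g (ract f c) = ract f (lact g c)"
proof (rule eq_if_dual_eq)
  fix h assume h: "h \<in> dual"
  have "h (lact g (ract f c)) = conv h g (ract f c)"
    by (rule apply_lact[OF h])
  also have "\<dots> = conv f (conv h g) c"
    by (rule apply_ract[OF conv_dual[OF h assms(2)]])
  also have "\<dots> = conv (conv f h) g c"
    by (simp add: conv_assoc assms h)
  also have "\<dots> = conv f h (lact g c)"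
    by (rule apply_lact[OF conv_dual[OF assms(1) h], symmetric])
  also have "\<dots> = h (ract f (lact g c))"
    by (rule apply_ract[OF h, symmetric])
  finally show "h (lact g (ract f c)) = h (ract f (lact g c))" .
qed

section \<open>The coefficient coalgebra of a simple comodule\<close>

text \<open>
  The coefficient space of \<open>T\<close> is spanned by the elements \<open>t\<^sub>1 g(t\<^sub>2)\<close>. Describing it as the common
  kernel of the annihilator makes it depend on \<open>ann T\<close> alone, and it is stable under both
  actions because \<open>ann T\<close> is a two-sided ideal.
\<close>

definition ann :: "'c set \<Rightarrow> ('c \<Rightarrow> 'k) set" where
  "ann T = {f \<in> dual. \<forall>t\<in>T. ract f t = 0}"

definition coeff :: "'c set \<Rightarrow> 'c set" where
  "coeff T = {c. \<forall>f\<in>ann T. f c = 0}"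

lemma ann_isomorphic: "right.isomorphic S T \<Longrightarrow> right.submodule S \<Longrightarrow> ann S = ann T"
  unfolding ann_def by (rule Collect_cong, rule conj_cong[OF HOL.refl])
    (rule right.isomorphic_annihilator)

lemma ann_conv:
  assumes "right.submodule T" and f: "f \<in> ann T" and g: "g \<in> dual"
  shows "conv f g \<in> ann T" and "conv g f \<in> ann T"
proof -
  have "ract (conv f g) t = 0" "ract (conv g f) t = 0" if "t \<in> T" for t
  proof -
    have "ract g t \<in> T" using assms(1) g that by (simp add: right.submodule_def)
    then show "ract (conv f g) t = 0" "ract (conv g f) t = 0"
      using f g that by (simp_all add: ann_def ract_conv right.act_zero)
  qed
  then show "conv f g \<in> ann T" and "conv g f \<in> ann T"
    using f g by (simp_all add: ann_def conv_dual)
qed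

lemma coeff_lact:
  assumes "right.submodule T" and "g \<in> dual" and "c \<in> coeff T"
  shows "lact g c \<in> coeff T"
proof -
  have "f (lact g c) = 0" if f: "f \<in> ann T" for f
    using ann_conv(1)[OF assms(1) f assms(2)] assms(3) f
    by (simp add: coeff_def ann_def apply_lact)
  then show ?thesis by (simp add: coeff_def)
qed

lemma submodule_coeff:
  assumes "right.submodule T"
  shows "right.submodule (coeff T)"
  unfolding right.submodule_def
proof (intro conjI ballI)
  show "subspace (coeff T)"
    by (rule subspaceI) (auto simp: coeff_def ann_def dual_zero dual_add dual_scale)
  fix g c assume g: "g \<in> dual" and c: "c \<in> coeff T"
  have "f (ract g c) = 0" if f: "f \<in> ann T" for f
    using ann_conv(2)[OF assms f g] c f by (simp add: coeff_def ann_def apply_ract)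
  then show "ract g c \<in> coeff T" by (simp add: coeff_def)
qed

lemma subset_coeff: "T \<subseteq> coeff T"
proof
  fix t assume t: "t \<in> T"
  have "f t = 0" if f: "f \<in> ann T" for f
  proof -
    have "f t = conv f \<epsilon> t" using f by (simp add: ann_def conv_counit_right)
    also have "\<dots> = \<epsilon> (ract f t)" by (simp add: apply_ract counit_dual)
    also have "\<dots> = 0" using f t by (simp add: ann_def dual_zero counit_dual)
    finally show ?thesis .
  qed
  then show "t \<in> coeff T" by (simp add: coeff_def)
qed

text \<open>
  Local finiteness: the cyclic module \<open>u \<cdot> C\<^sup>*\<close> lies in the span of the right tensor factors of \<open>\<Delta> u\<close>.
\<close>

lemma ract_in_span: "ract f u \<in> span (snd ` set (\<Delta> u))"
  unfolding slice_def
proof (rule subspace_sum_list, simp, intro ballI)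
  fix l assume "l \<in> set (\<Delta> u)"
  then have "snd l \<in> span (snd ` set (\<Delta> u))" by (intro span_base imageI)
  then show "(case l of (x, y) \<Rightarrow> scale (f x) y) \<in> span (snd ` set (\<Delta> u))"
    by (simp add: case_prod_unfold span_scale)
qed

text \<open>
  A simple module is cyclic, hence finite dimensional by \<open>ract_in_span\<close>.
\<close>

lemma simple_finite_dimensional:
  assumes T: "right.simple T"
  obtains B where "finite B" and "B \<subseteq> T" and "T \<subseteq> span B"
proof -
  have sub: "right.submodule T" using T by (simp add: right.simple_def)
  then have "0 \<in> T" by (simp add: right.submodule_def subspace_0)
  then obtain t where t: "t \<in> T" "t \<noteq> 0" using T by (auto simp: right.simple_def)
  define U where "U = (\<lambda>f. ract f t) ` dual"
  have "right.submodule U"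
    unfolding right.submodule_def
  proof (intro conjI ballI)
    have add: "ract (\<lambda>c. f c + g c) t = ract f t + ract g t" for f g
      by (simp add: slice_def case_prod_unfold scale_left_distrib sum_list_addf)
    have scale: "ract (\<lambda>c. a * f c) t = scale a (ract f t)" for a f
      by (simp add: slice_def case_prod_unfold scale_sum_list)
    show "subspace U"
    proof (rule subspaceI)
      have "(\<lambda>c. 0) \<in> dual" by (simp add: dual_iff)
      moreover have "ract (\<lambda>c. 0) t = 0" using scale[of 0] by simp
      ultimately show "0 \<in> U" by (force simp: U_def)
    next
      fix x y assume "x \<in> U" "y \<in> U"
      then obtain f g where "f \<in> dual" "g \<in> dual" and xy: "x = ract f t" "y = ract g t"
        by (auto simp: U_def)
      then have "(\<lambda>c. f c + g c) \<in> dual" by (simp add: dual_iff algebra_simps)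
      then show "x + y \<in> U" unfolding U_def xy add[symmetric] by (rule imageI)
    next
      fix a x assume "x \<in> U"
      then obtain f where "f \<in> dual" and x: "x = ract f t" by (auto simp: U_def)
      then have "(\<lambda>c. a * f c) \<in> dual" by (simp add: dual_iff algebra_simps)
      then show "scale a x \<in> U" unfolding U_def x scale[symmetric] by (rule imageI)
    qed
    show "ract f x \<in> U" if "f \<in> dual" "x \<in> U" for f x
      using that by (auto simp: U_def conv_dual simp flip: ract_conv)
  qed
  moreover have "U \<subseteq> T" using sub t by (auto simp: U_def right.submodule_def)
  moreover have "t \<in> U"
    using ract_counit[of t] counit_dual unfolding U_def by (metis imageI)
  ultimately have "T = U" using T t unfolding right.simple_def by blast
  then have T_sub: "T \<subseteq> span (snd ` set (\<Delta> t))"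
    using ract_in_span by (auto simp: U_def)
  obtain B where B: "B \<subseteq> T" "independent B" "T \<subseteq> span B"
    using maximal_independent_subset by blast
  have "B \<subseteq> span (snd ` set (\<Delta> t))" using B(1) T_sub by blast
  from independent_span_bound[OF _ B(2) this] have "finite B" by simp
  then show thesis using that B by blast
qed

text \<open>
  A functional vanishing on the left tensor factors of \<open>\<Delta> b\<close> for all \<open>b\<close> in a finite spanning set
  annihilates \<open>T\<close>, so the coefficients lie in the span of these factors.
\<close>

lemma coeff_finite_dimensional:
  assumes T: "right.simple T"
  obtains W where "finite W" and "coeff T \<subseteq> span W"
proof -
  obtain B where B: "finite B" "B \<subseteq> T" "T \<subseteq> span B"
    using simple_finite_dimensional[OF T] .
  define W where "W = (\<Union>b\<in>B. fst ` set (\<Delta> b))"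
  have "c \<in> span W" if c: "c \<in> coeff T" for c
  proof (rule ccontr)
    assume "c \<notin> span W"
    then obtain f where f: "f \<in> dual" "\<forall>w\<in>span W. f w = 0" and fc: "f c \<noteq> 0"
      using functional_separates[OF subspace_span] unfolding dual_def by blast
    have ract_B: "ract f b = 0" if "b \<in> B" for b
    proof -
      have "f (fst l) = 0" if "l \<in> set (\<Delta> b)" for l
        using f(2) \<open>b \<in> B\<close> that by (auto simp: W_def intro!: span_base)
      then have zero: "map (\<lambda>(x, y). scale (f x) y) (\<Delta> b) = map (\<lambda>_. 0) (\<Delta> b)"
        by (intro map_cong) auto
      show ?thesis unfolding slice_def zero by simp
    qed
    have "ract f t = 0" if "t \<in> span B" for t
      using that
      by (induction rule: span_induct_alt)
        (simp_all add: right.act_add right.act_scale right.act_zero f(1) ract_B)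
    then have "f \<in> ann T" using B(3) f(1) by (auto simp: ann_def)
    then show False using c fc by (simp add: coeff_def)
  qed
  moreover have "finite W" using B(1) by (simp add: W_def)
  ultimately show thesis using that by blast
qed

text \<open>
  As a right module, the coefficient coalgebra of \<open>T\<close> is a sum of copies of \<open>T\<close>, namely of the
  non-zero translates of \<open>T\<close> under the commuting left action: a functional vanishing on all
  translates annihilates \<open>T\<close>, because \<open>g(t \<cdot> f) = f(t\<^sub>1) g(t\<^sub>2)\<close>.
\<close>

lemma coeff_sum:
  assumes T: "right.simple T"
  shows "coeff T \<subseteq> span (\<Union>{Y. right.simple Y \<and> ann Y = ann T})"
    (is "_ \<subseteq> span (\<Union>?\<Y>)")
proof (rule ccontr)
  assume "\<not> ?thesis"
  then obtain c where c: "c \<in> coeff T" "c \<notin> span (\<Union>?\<Y>)" by blast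
  obtain f where f: "f \<in> dual" "\<forall>w\<in>span (\<Union>?\<Y>). f w = 0" and fc: "f c \<noteq> 0"
    using functional_separates[OF subspace_span c(2)] unfolding dual_def by blast
  have sub: "right.submodule T" using T by (simp add: right.simple_def)
  have f_lact: "f (lact g t) = 0" if g: "g \<in> dual" and t: "t \<in> T" for g t
  proof (cases "lact g ` T = {0}")
    case True
    then have "lact g t = 0" using t by blast
    then show ?thesis using f(1) by (simp add: dual_zero)
  next
    case False
    have inj: "inj_on (lact g) T \<and> right.simple (lact g ` T)"
    proof (rule right.simple_image[OF vector_space_axioms, where actN = ract])
      show "subspace T" "\<forall>f\<in>dual. \<forall>x\<in>T. ract f x \<in> T"
        using sub by (simp_all add: right.submodule_def)
      show "\<forall>P\<subseteq>T. subspace P \<and> (\<forall>f\<in>dual. \<forall>x\<in>P. ract f x \<in> P) \<longrightarrow> P = {0} \<or> P = T"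
        using T by (simp add: right.simple_def right.submodule_def)
    qed (simp_all add: g False lact_add lact_scale lact_ract)
    then have "right.isomorphic T (lact g ` T)"
      unfolding right.isomorphic_def bij_betw_def using g
      by (intro exI[of _ "lact g"]) (auto simp: lact_add lact_scale lact_ract)
    then have "lact g ` T \<in> ?\<Y>"
      using inj ann_isomorphic sub by blast
    then show ?thesis using f(2) t by (auto intro: span_base)
  qed
  have "ract f t = 0" if t: "t \<in> T" for t
  proof (rule eq_if_dual_eq)
    fix g assume g: "g \<in> dual"
    have "g (ract f t) = f (lact g t)" using f(1) g by (simp add: apply_ract apply_lact)
    then show "g (ract f t) = g 0" using f_lact g t by (simp add: dual_zero)
  qed
  then have "f \<in> ann T" using f(1) by (simp add: ann_def)
  then show False using c(1) fc by (simp add: coeff_def)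
qed

definition coeff_complement :: "'c set \<Rightarrow> 'c set" where
  "coeff_complement T = span (\<Union>{coeff S | S. right.simple S \<and> ann S \<noteq> ann T})"

lemma submodule_coeff_complement: "right.submodule (coeff_complement T)"
  unfolding coeff_complement_def
proof (rule right.submodule_span_Union, intro ballI)
  fix X assume "X \<in> {coeff S | S. right.simple S \<and> ann S \<noteq> ann T}"
  then obtain S where "X = coeff S" "right.simple S" by blast
  then show "right.submodule X" by (simp add: right.simple_def submodule_coeff)
qed

lemma lact_coeff_complement:
  assumes g: "g \<in> dual" and "c \<in> coeff_complement T"
  shows "lact g c \<in> coeff_complement T"
  using assms(2) unfolding coeff_complement_def
proof (induction rule: span_induct_alt)
  case base
  have "lact g 0 = 0" using lact_scale[OF g, of 0 0] by simp
  then show ?case by (simp add: span_zero)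
next
  case (step a x y)
  then obtain S where S: "right.simple S" "ann S \<noteq> ann T" "x \<in> coeff S" by blast
  then have "lact g x \<in> coeff S" using coeff_lact g by (simp add: right.simple_def)
  then have "lact g x \<in> span (\<Union>{coeff S | S. right.simple S \<and> ann S \<noteq> ann T})"
    using S by (intro span_base) blast
  then show ?case
    using step.IH g by (simp add: lact_add lact_scale span_add span_scale)
qed

text \<open>
  A simple submodule of the intersection would have the annihilator of \<open>T\<close> as part of a sum of
  copies of \<open>T\<close>, and a different one as part of the complement.
\<close>

lemma coeff_disjoint_complement:
  assumes T: "right.simple T"
  shows "coeff T \<inter> coeff_complement T = {0}"
proof (rule ccontr)
  let ?U = "coeff T \<inter> coeff_complement T"
  assume "?U \<noteq> {0}"
  have "right.submodule ?U"
    using T by (intro right.submodule_Int submodule_coeff submodule_coeff_complement)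
      (simp add: right.simple_def)
  moreover obtain W where "finite W" "coeff T \<subseteq> span W"
    using coeff_finite_dimensional[OF T] .
  ultimately obtain X where X: "right.simple X" "X \<subseteq> ?U"
    using right.simple_submodule_exists[of ?U W] \<open>?U \<noteq> {0}\<close> by blast
  then have subX: "right.submodule X" by (simp add: right.simple_def)
  have "X \<subseteq> span (\<Union>{Y. right.simple Y \<and> ann Y = ann T})"
    using X(2) coeff_sum[OF T] by blast
  then have "ann X = ann T"
    using right.simple_in_sum[OF X(1), of "{Y. right.simple Y \<and> ann Y = ann T}"]
      ann_isomorphic[OF _ subX] by blast
  let ?\<Y> = "{Y. right.simple Y \<and> ann Y \<noteq> ann T}"
  have "coeff S \<subseteq> span (\<Union>?\<Y>)" if S: "right.simple S" "ann S \<noteq> ann T" for S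
  proof -
    have "span (\<Union>{Y. right.simple Y \<and> ann Y = ann S}) \<subseteq> span (\<Union>?\<Y>)"
      by (rule span_mono) (use S in auto)
    then show ?thesis using coeff_sum[OF S(1)] by blast
  qed
  then have "coeff_complement T \<subseteq> span (\<Union>?\<Y>)"
    unfolding coeff_complement_def by (intro span_minimal) auto
  then have "X \<subseteq> span (\<Union>?\<Y>)" using X(2) by blast
  then obtain Y where "ann Y \<noteq> ann T" "right.isomorphic X Y"
    using right.simple_in_sum[OF X(1), of ?\<Y>] by blast
  then show False
    using ann_isomorphic[OF _ subX] \<open>ann X = ann T\<close> by blast
qed

lemma coeff_subset_coradical:
  assumes "right.simple T"
  shows "coeff T \<subseteq> coradical"
proof -
  have "span (\<Union>{Y. right.simple Y \<and> ann Y = ann T}) \<subseteq> coradical"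
    unfolding coradical_eq by (rule span_mono) blast
  with coeff_sum[OF assms] show ?thesis by (rule subset_trans)
qed

lemma coradical_decomposition:
  assumes T: "right.simple T"
  shows "coradical = span (coeff T \<union> coeff_complement T)"
proof
  have "S \<subseteq> coeff T \<union> coeff_complement T" if S: "right.simple S" for S
  proof (cases "ann S = ann T")
    case True
    then have "coeff S = coeff T" by (simp add: coeff_def)
    then show ?thesis using subset_coeff[of S] by blast
  next
    case False
    then have "coeff S \<in> {coeff S | S. right.simple S \<and> ann S \<noteq> ann T}"
      using S by blast
    then have "coeff S \<subseteq> coeff_complement T"
      unfolding coeff_complement_def by (rule subset_trans[OF Union_upper span_superset])
    then show ?thesis using subset_coeff[of S] by blast
  qed
  then show "coradical \<subseteq> span (coeff T \<union> coeff_complement T)"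
    unfolding coradical_eq by (intro span_mono) blast
next
  have sub: "subspace coradical" by (simp add: coradical_def)
  have "\<Union>{coeff S | S. right.simple S \<and> ann S \<noteq> ann T} \<subseteq> coradical"
    using coeff_subset_coradical by blast
  then have "coeff_complement T \<subseteq> coradical"
    unfolding coeff_complement_def using sub by (rule span_minimal)
  then have "coeff T \<union> coeff_complement T \<subseteq> coradical"
    using coeff_subset_coradical[OF T] by blast
  then show "span (coeff T \<union> coeff_complement T) \<subseteq> coradical"
    using sub by (rule span_minimal)
qed

lemma submodule_coradical: "right.submodule coradical"
  unfolding coradical_eq by (rule right.submodule_span_Union) (simp add: right.simple_def)

end

section \<open>Rational modules\<close>

lemma sum_list_fun_apply: "(\<Sum>x\<leftarrow>xs. F x) i = (\<Sum>x\<leftarrow>xs. F x i)"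
  by (induction xs) simp_all

lemma vector_space_scale_fun: "vector_space (scale_fun :: 'k::field \<Rightarrow> (nat \<Rightarrow> 'c \<Rightarrow> 'k) \<Rightarrow> _)"
  by unfold_locales (simp_all add: scale_fun_def fun_eq_iff algebra_simps)

context coalgebra
begin

text \<open>
  The coaction is any choice of expansions \<open>f \<cdot> n = \<Sum>\<^sub>i f(c\<^sub>i) n\<^sub>i\<close>. It is linear and coassociative as a
  map into tensors, since its contractions are given by the action, which is additive and
  compatible with convolution.
\<close>

lemma rationalI:
  assumes M: "left_dual_module sM N act"
    and exp: "\<forall>n\<in>N. \<exists>t. fst ` set t \<subseteq> N \<and> (\<forall>f\<in>dual. act f n = (\<Sum>(x, y)\<leftarrow>t. sM (f y) x))"
  shows "rational sM N act"
proof -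
  have V: "vector_space sM" and sub: "module.subspace sM N"
    and act_add: "\<And>f m m'. f \<in> dual \<Longrightarrow> m \<in> N \<Longrightarrow> m' \<in> N \<Longrightarrow> act f (m + m') = act f m + act f m'"
    and act_scale: "\<And>a f m. f \<in> dual \<Longrightarrow> m \<in> N \<Longrightarrow> act f (sM a m) = sM a (act f m)"
    and act_conv: "\<And>f g m. f \<in> dual \<Longrightarrow> g \<in> dual \<Longrightarrow> m \<in> N \<Longrightarrow> act (conv f g) m = act f (act g m)"
    and act_counit: "\<And>m. m \<in> N \<Longrightarrow> act \<epsilon> m = m"
    using M by (simp_all add: left_dual_module_def)
  interpret V: vector_space sM by (rule V)
  obtain \<rho> where "\<forall>n\<in>N. fst ` set (\<rho> n) \<subseteq> N \<and> (\<forall>f\<in>dual. act f n = (\<Sum>(x, y)\<leftarrow>\<rho> n. sM (f y) x))"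
    using bchoice[OF exp] by (rule exE)
  then have \<rho>N: "fst ` set (\<rho> n) \<subseteq> N"
    and \<rho>: "f \<in> dual \<Longrightarrow> act f n = (\<Sum>(x, y)\<leftarrow>\<rho> n. sM (f y) x)" if "n \<in> N" for n f
    using that by simp_all
  have act_sum: "act f (\<Sum>l\<leftarrow>ls. sM (k l) (v l)) = (\<Sum>l\<leftarrow>ls. sM (k l) (act f (v l)))"
    if f: "f \<in> dual" and v: "\<forall>l\<in>set ls. v l \<in> N" for f ls k v
    using v
  proof (induction ls)
    case Nil
    show ?case using act_scale[OF f V.subspace_0[OF sub], of 0] by simp
  next
    case (Cons l ls)
    have "(\<Sum>l\<leftarrow>ls. sM (k l) (v l)) \<in> N"
      using Cons.prems sub by (intro V.subspace_sum_list) (auto intro: V.subspace_scale)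
    then show ?case
      using Cons sub by (simp add: act_add[OF f] act_scale[OF f] V.subspace_scale)
  qed
  have "right_comodule sM N \<rho>"
    unfolding right_comodule_def
  proof (intro conjI ballI)
    show "vector_space sM" "V.subspace N" by (fact V, fact sub)
    show "fst ` set (\<rho> n) \<subseteq> N" if "n \<in> N" for n by (rule \<rho>N[OF that])
    show "linear_into_tensor sM sM scale N \<rho>"
      unfolding linear_into_tensor_def
    proof (intro conjI ballI allI)
      fix x y assume xy: "x \<in> N" "y \<in> N"
      show "tensor_eq sM scale (\<rho> (x + y)) (\<rho> x @ \<rho> y)"
      proof (rule tensor_eqI_right[OF V vector_space_axioms])
        fix f assume "Vector_Spaces.linear scale (*) f"
        then have f: "f \<in> dual" by (simp add: dual_def)
        show "(\<Sum>(x, y)\<leftarrow>\<rho> (x + y). sM (f y) x) = (\<Sum>(x, y)\<leftarrow>\<rho> x @ \<rho> y. sM (f y) x)"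
          using \<rho>[OF xy(1) f] \<rho>[OF xy(2) f] \<rho>[OF V.subspace_add[OF sub xy] f] act_add[OF f xy]
          by simp
      qed
    next
      fix a x assume x: "x \<in> N"
      show "tensor_eq sM scale (\<rho> (sM a x)) (map (\<lambda>(u, v). (sM a u, v)) (\<rho> x))"
      proof (rule tensor_eqI_right[OF V vector_space_axioms])
        fix f assume "Vector_Spaces.linear scale (*) f"
        then have f: "f \<in> dual" by (simp add: dual_def)
        have "(\<Sum>(x, y)\<leftarrow>\<rho> (sM a x). sM (f y) x) = sM a (act f x)"
          using \<rho>[OF V.subspace_scale[OF sub x, of a] f] act_scale[OF f x] by simp
        also have "\<dots> = (\<Sum>(x, y)\<leftarrow>map (\<lambda>(u, v). (sM a u, v)) (\<rho> x). sM (f y) x)"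
          by (simp add: \<rho>[OF x f] V.scale_sum_list case_prod_unfold comp_def mult.commute)
        finally show "(\<Sum>(x, y)\<leftarrow>\<rho> (sM a x). sM (f y) x) = \<dots>" .
      qed
    qed
    fix n assume n: "n \<in> N"
    show "tensor3_eq sM scale scale [(u, v, y). (x, y) \<leftarrow> \<rho> n, (u, v) \<leftarrow> \<rho> x]
        [(x, u, v). (x, y) \<leftarrow> \<rho> n, (u, v) \<leftarrow> \<Delta> y]"
    proof (rule tensor3_eqI[OF V vector_space_axioms vector_space_axioms])
      fix f g
      assume "Vector_Spaces.linear scale (*) f" "Vector_Spaces.linear scale (*) g"
      then have f: "f \<in> dual" and g: "g \<in> dual" by (simp_all add: dual_def)
      have "(\<Sum>(x, y, z)\<leftarrow>[(u, v, y). (x, y) \<leftarrow> \<rho> n, (u, v) \<leftarrow> \<rho> x]. sM (f y * g z) x)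
          = (\<Sum>(x, y)\<leftarrow>\<rho> n. sM (g y) (\<Sum>(u, v)\<leftarrow>\<rho> x. sM (f v) u))"
        by (simp add: case_prod_unfold comp_def sum_list_map_concat V.scale_sum_list mult.commute)
      also have "\<dots> = (\<Sum>(x, y)\<leftarrow>\<rho> n. sM (g y) (act f x))"
        by (rule arg_cong[where f = sum_list], rule map_cong[OF HOL.refl])
          (use \<rho>N[OF n] \<rho>[OF _ f] in auto)
      also have "\<dots> = act f (\<Sum>(x, y)\<leftarrow>\<rho> n. sM (g y) x)"
        using act_sum[OF f, of "\<rho> n" fst "\<lambda>l. g (snd l)"] \<rho>N[OF n]
        by (simp add: case_prod_unfold image_subset_iff)
      also have "\<dots> = act (conv f g) n"
        by (simp add: act_conv[OF f g n] \<rho>[OF n g])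
      also have "\<dots> = (\<Sum>(x, y)\<leftarrow>\<rho> n. sM (conv f g y) x)"
        by (rule \<rho>[OF n conv_dual[OF f g]])
      also have "\<dots> = (\<Sum>(x, y, z)\<leftarrow>[(x, u, v). (x, y) \<leftarrow> \<rho> n, (u, v) \<leftarrow> \<Delta> y]. sM (f y * g z) x)"
        by (simp add: conv_def case_prod_unfold comp_def sum_list_map_concat V.sum_list_scale)
      finally show "(\<Sum>(x, y, z)\<leftarrow>[(u, v, y). (x, y) \<leftarrow> \<rho> n, (u, v) \<leftarrow> \<rho> x]. sM (f y * g z) x) = \<dots>" .
    qed
    show "(\<Sum>(x, y)\<leftarrow>\<rho> n. sM (\<epsilon> y) x) = n"
      using \<rho>[OF n counit_dual] act_counit[OF n] by simp
  qed
  then show ?thesis unfolding rational_def using \<rho> by blast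
qed

lemma left_dual_submodule:
  assumes "left_dual_module sM M act" and "dual_submodule sM M act N"
  shows "left_dual_module sM N act"
  using assms unfolding left_dual_module_def dual_submodule_def by (simp add: subset_iff)

lemma Rat_expansion:
  assumes M: "left_dual_module sM M act" and m: "m \<in> Rat sM M act"
  shows "\<exists>t. \<forall>f\<in>dual. act f m = (\<Sum>(x, y)\<leftarrow>t. sM (f y) x)"
proof -
  have V: "vector_space sM" and sub: "module.subspace sM M"
    and act_add: "\<And>f m m'. f \<in> dual \<Longrightarrow> m \<in> M \<Longrightarrow> m' \<in> M \<Longrightarrow> act f (m + m') = act f m + act f m'"
    and act_scale: "\<And>a f m. f \<in> dual \<Longrightarrow> m \<in> M \<Longrightarrow> act f (sM a m) = sM a (act f m)"
    using M by (simp_all add: left_dual_module_def)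
  interpret V: vector_space sM by (rule V)
  have "m \<in> M \<and> (\<exists>t. \<forall>f\<in>dual. act f m = (\<Sum>(x, y)\<leftarrow>t. sM (f y) x))"
    using m unfolding Rat_def
  proof (induction rule: V.span_induct_alt)
    case base
    have "\<forall>f\<in>dual. act f 0 = (\<Sum>(x, y)\<leftarrow>[]. sM (f y) x)"
      using act_scale[OF _ V.subspace_0[OF sub], of _ 0] by simp
    then show ?case using V.subspace_0[OF sub] by blast
  next
    case (step a x y)
    from step(1) obtain N \<rho> where N: "x \<in> N" "dual_submodule sM M act N"
      and \<rho>: "\<forall>f\<in>dual. \<forall>n\<in>N. act f n = (\<Sum>(x, y)\<leftarrow>\<rho> n. sM (f y) x)"
      unfolding rational_def by blast
    from step.IH obtain t where y: "y \<in> M"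
      and t: "\<forall>f\<in>dual. act f y = (\<Sum>(x, y)\<leftarrow>t. sM (f y) x)" by blast
    have x: "x \<in> M" using N by (auto simp: dual_submodule_def)
    have ax: "sM a x \<in> M" by (rule V.subspace_scale[OF sub x])
    have "act f (sM a x + y) = (\<Sum>(x, y)\<leftarrow>map (\<lambda>(u, v). (sM a u, v)) (\<rho> x) @ t. sM (f y) x)"
      if f: "f \<in> dual" for f
    proof -
      have "act f (sM a x + y) = sM a (act f x) + act f y"
        by (simp add: act_add[OF f ax y] act_scale[OF f x])
      then show ?thesis
        using \<rho> t f N(1) by (simp add: case_prod_unfold comp_def V.scale_sum_list mult.commute)
    qed
    moreover have "sM a x + y \<in> M" by (rule V.subspace_add[OF sub ax y])
    ultimately show ?case by blast
  qed
  then show ?thesis by blast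
qed

section \<open>The coradical is finite dimensional\<close>

text \<open>
  The dual of a submodule \<open>D\<close> of \<open>C\<close>, realised by the restrictions of functionals to \<open>D\<close>, continued
  by zero. They are constant in the first argument, which is there to number the generators of a
  module: this one is generated by the restriction of the counit.
\<close>

definition restr :: "'c set \<Rightarrow> ('c \<Rightarrow> 'k) \<Rightarrow> nat \<Rightarrow> 'c \<Rightarrow> 'k" where
  "restr D f = (\<lambda>i c. if c \<in> D then f c else 0)"

text \<open>
  The transpose of the right action on \<open>D\<close>.
\<close>

definition restr_act :: "'c set \<Rightarrow> ('c \<Rightarrow> 'k) \<Rightarrow> (nat \<Rightarrow> 'c \<Rightarrow> 'k) \<Rightarrow> nat \<Rightarrow> 'c \<Rightarrow> 'k" where
  "restr_act D f m = (\<lambda>i c. if c \<in> D then m i (ract f c) else 0)"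

lemma restr_act_restr:
  assumes "right.submodule D" and "f \<in> dual" and "g \<in> dual"
  shows "restr_act D f (restr D g) = restr D (conv f g)"
  using assms by (auto simp: restr_act_def restr_def fun_eq_iff right.submodule_def apply_ract)

lemma restr_add: "restr D f + restr D g = restr D (\<lambda>c. f c + g c)"
  by (simp add: restr_def fun_eq_iff)

lemma restr_scale: "scale_fun a (restr D f) = restr D (\<lambda>c. a * f c)"
  by (simp add: restr_def scale_fun_def fun_eq_iff)

lemma left_dual_module_restr:
  assumes D: "right.submodule D"
  shows "left_dual_module scale_fun (restr D ` dual) (restr_act D)"
  unfolding left_dual_module_def
proof (intro conjI ballI allI)
  interpret V: vector_space "scale_fun :: 'k \<Rightarrow> (nat \<Rightarrow> 'c \<Rightarrow> 'k) \<Rightarrow> _"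
    by (rule vector_space_scale_fun)
  show "vector_space (scale_fun :: 'k \<Rightarrow> (nat \<Rightarrow> 'c \<Rightarrow> 'k) \<Rightarrow> _)"
    by (rule vector_space_scale_fun)
  show "V.subspace (restr D ` dual)"
  proof (rule V.subspaceI)
    have "0 = restr D (\<lambda>c. 0)" by (simp add: restr_def fun_eq_iff)
    then show "0 \<in> restr D ` dual" using dual_const_zero by blast
  qed (auto simp: restr_add restr_scale dual_plus dual_times)
  fix f m assume f: "f \<in> dual" and m: "m \<in> restr D ` dual"
  show "restr_act D f m \<in> restr D ` dual"
    using f m by (auto simp: restr_act_restr D conv_dual)
  show "restr_act D f (m + m') = restr_act D f m + restr_act D f m'" for m'
    by (simp add: restr_act_def fun_eq_iff)
  show "restr_act D f (scale_fun a m) = scale_fun a (restr_act D f m)" for a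
    by (simp add: restr_act_def scale_fun_def fun_eq_iff)
  from m obtain q where q: "q \<in> dual" and mq: "m = restr D q" by blast
  have conv_add: "conv (\<lambda>c. f c + g c) q = (\<lambda>c. conv f q c + conv g q c)" for g
    by (simp add: conv_def fun_eq_iff case_prod_unfold distrib_right sum_list_addf)
  have conv_times: "conv (\<lambda>c. a * f c) q = (\<lambda>c. a * conv f q c)" for a
    by (simp add: conv_def fun_eq_iff case_prod_unfold mult.assoc sum_list_const_mult)
  show "restr_act D (\<lambda>c. f c + g c) m = restr_act D f m + restr_act D g m" if "g \<in> dual" for g
    using f q that D by (simp add: mq restr_act_restr dual_plus conv_add restr_add)
  show "restr_act D (\<lambda>c. a * f c) m = scale_fun a (restr_act D f m)" for a
    using f q D by (simp add: mq restr_act_restr dual_times conv_times restr_scale)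
  show "restr_act D (conv f g) m = restr_act D f (restr_act D g m)" if "g \<in> dual" for g
    using f q that D by (simp add: mq restr_act_restr conv_dual conv_assoc)
next
  fix m assume "m \<in> restr D ` dual"
  then show "restr_act D \<epsilon> m = m"
    using D by (auto simp: restr_act_restr counit_dual conv_counit_left)
qed

lemma finitely_generated_restr:
  assumes D: "right.submodule D"
  shows "finitely_generated (restr D ` dual) (restr_act D)"
  unfolding finitely_generated_def
proof (intro exI[of _ "{restr D \<epsilon>}"] conjI ballI)
  show "{restr D \<epsilon>} \<subseteq> restr D ` dual" using counit_dual by blast
  fix m assume "m \<in> restr D ` dual"
  then obtain q where q: "q \<in> dual" "m = restr D q" by blast
  then have "m = (\<Sum>x\<in>{restr D \<epsilon>}. restr_act D q x)"
    using D by (simp add: restr_act_restr counit_dual conv_counit_right)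
  then show "\<exists>f. (\<forall>x\<in>{restr D \<epsilon>}. f x \<in> dual) \<and> m = (\<Sum>x\<in>{restr D \<epsilon>}. restr_act D (f x) x)"
    using q by (intro exI[of _ "\<lambda>_. q"]) simp
qed simp

text \<open>
  Expand \<open>a = \<Sum>\<^sub>b \<beta>\<^sub>b(a) b\<close> on the finite-dimensional space \<open>coeff T\<close>. If \<open>m\<close> vanishes on the
  complement, then \<open>f \<cdot> m = \<Sum>\<^sub>b f(b) (\<beta>\<^sub>b \<cdot> m)\<close>: both sides vanish on the complement, and on
  \<open>coeff T\<close>, which is stable under the left action, this is the expansion of \<open>m(c\<^sub>2) c\<^sub>1\<close>.
\<close>

lemma Rat_if_supported_on_coeff:
  assumes T: "right.simple T" and q: "q \<in> dual" and vanish: "\<forall>c\<in>coeff_complement T. q c = 0"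
  shows "restr coradical q \<in> Rat scale_fun (restr coradical ` dual) (restr_act coradical)"
proof -
  let ?D = coradical and ?E = "coeff_complement T"
  let ?M = "restr ?D ` dual" and ?act = "restr_act ?D"
  interpret V: vector_space "scale_fun :: 'k \<Rightarrow> (nat \<Rightarrow> 'c \<Rightarrow> 'k) \<Rightarrow> _"
    by (rule vector_space_scale_fun)
  note D = submodule_coradical
  have M: "left_dual_module scale_fun ?M ?act" by (rule left_dual_module_restr[OF D])
  have subT: "right.submodule T" using T by (simp add: right.simple_def)
  have E_ract: "ract f c \<in> ?E" if "f \<in> dual" "c \<in> ?E" for f c
    using submodule_coeff_complement that by (simp add: right.submodule_def)
  have E_D: "?E \<subseteq> ?D"
    using coradical_decomposition[OF T] span_superset[of "coeff T \<union> ?E"] by simp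
  define N where "N = restr ?D ` {q \<in> dual. \<forall>c\<in>?E. q c = 0}"
  have conv_vanish: "conv f q c = 0" if "f \<in> dual" "q \<in> dual" "\<forall>c\<in>?E. q c = 0" "c \<in> ?E" for f q c
    using that E_ract by (simp flip: apply_ract)
  have N: "dual_submodule scale_fun ?M ?act N"
    unfolding dual_submodule_def
  proof (intro conjI ballI)
    show "N \<subseteq> ?M" by (auto simp: N_def)
    show "V.subspace N"
    proof (rule V.subspaceI)
      have "0 = restr ?D (\<lambda>c. 0)" by (simp add: restr_def fun_eq_iff)
      then show "0 \<in> N" unfolding N_def using dual_const_zero by blast
    qed (auto simp: N_def restr_add restr_scale dual_plus dual_times)
    show "?act f n \<in> N" if "f \<in> dual" "n \<in> N" for f n
      using that conv_vanish by (auto simp: N_def restr_act_restr D conv_dual)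
  qed
  obtain W where W: "finite W" "coeff T \<subseteq> span W"
    using coeff_finite_dimensional[OF T] .
  obtain bs \<beta> where "\<forall>b. Vector_Spaces.linear scale (*) (\<beta> b)"
    and exp: "\<forall>v\<in>span W. v = (\<Sum>b\<leftarrow>bs. scale (\<beta> b v) b)"
    using finite_coordinates[OF W(1)] by metis
  then have \<beta>: "\<beta> b \<in> dual" for b by (simp add: dual_def)
  have "rational scale_fun N ?act"
  proof (rule rationalI[OF left_dual_submodule[OF M N]], intro ballI)
    fix n assume n: "n \<in> N"
    then obtain q where q: "q \<in> dual" "\<forall>c\<in>?E. q c = 0" and nq: "n = restr ?D q"
      by (auto simp: N_def)
    have "?act f n = (\<Sum>b\<leftarrow>bs. scale_fun (f b) (?act (\<beta> b) n))" if f: "f \<in> dual" for f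
    proof -
      define s where "s = (\<lambda>c. \<Sum>b\<leftarrow>bs. f b * conv (\<beta> b) q c)"
      have s: "s \<in> dual"
        unfolding s_def dual_iff using conv_dual[OF \<beta> q(1)]
        by (simp add: dual_add dual_scale distrib_left sum_list_addf mult.left_commute
            sum_list_const_mult)
      have "conv f q c = s c" if c: "c \<in> coeff T \<union> ?E" for c
      proof (cases "c \<in> ?E")
        case True
        then have "conv g q c = 0" if "g \<in> dual" for g
          using conv_vanish[OF that q] by simp
        then show ?thesis using f \<beta> by (simp add: s_def)
      next
        case False
        then have "lact q c \<in> span W"
          using c coeff_lact[OF subT q(1)] W(2) by blast
        then have "f (lact q c) = f (\<Sum>b\<leftarrow>bs. scale (\<beta> b (lact q c)) b)"
          using exp by metis
        also have "\<dots> = (\<Sum>b\<leftarrow>bs. \<beta> b (lact q c) * f b)"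
          using f by (simp add: dual_sum_list dual_scale)
        finally show ?thesis
          using f \<beta> by (simp add: s_def apply_lact mult.commute)
      qed
      then have "conv f q c = s c" if "c \<in> ?D" for c
        using functional_eq_on_span[of "conv f q" s "coeff T \<union> ?E" c] conv_dual[OF f q(1)] s that
        by (simp add: coradical_decomposition[OF T] dual_def)
      moreover have "?act g n = restr ?D (conv g q)" if "g \<in> dual" for g
        unfolding nq by (rule restr_act_restr[OF D that q(1)])
      ultimately show ?thesis
        using f \<beta> by (simp add: restr_def fun_eq_iff sum_list_fun_apply scale_fun_def s_def)
    qed
    moreover have "?act (\<beta> b) n \<in> N" for b
      using N n \<beta> by (simp add: dual_submodule_def)
    ultimately show "\<exists>t. fst ` set t \<subseteq> N \<and>
        (\<forall>f\<in>dual. ?act f n = (\<Sum>(x, y)\<leftarrow>t. scale_fun (f y) x))"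
      by (intro exI[of _ "map (\<lambda>b. (?act (\<beta> b) n, b)) bs"]) (auto simp: comp_def)
  qed
  with N have "N \<in> {N. dual_submodule scale_fun ?M ?act N \<and> rational scale_fun N ?act}"
    by simp
  then have "N \<subseteq> Rat scale_fun ?M ?act"
    unfolding Rat_def by (rule subset_trans[OF Union_upper V.span_superset])
  moreover have "restr ?D q \<in> N" using q vanish by (auto simp: N_def)
  ultimately show ?thesis by blast
qed

text \<open>
  The complement \<open>P\<close> of the rational part is zero: multiplying \<open>p \<in> P\<close> by the functional that cuts
  out \<open>coeff T\<close> gives a rational element of \<open>P\<close> with the same values on \<open>T\<close>. So the generator of the
  module is rational, and the span of the \<open>c\<^sub>i\<close> in its expansion contains the coradical.
\<close>

lemma coradical_in_finite_span:
  assumes split: "direct_summand scale_fun (restr coradical ` dual) (restr_act coradical)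
      (Rat scale_fun (restr coradical ` dual) (restr_act coradical))"
  obtains W where "finite W" and "coradical \<subseteq> span W"
proof -
  let ?D = coradical
  let ?M = "restr ?D ` dual" and ?act = "restr_act ?D"
  let ?R = "Rat scale_fun ?M ?act"
  note D = submodule_coradical
  obtain P where P: "dual_submodule scale_fun ?M ?act P" and RP: "?R \<inter> P = {0}"
    and sum: "\<forall>m\<in>?M. \<exists>n\<in>?R. \<exists>p\<in>P. m = n + p"
    using split unfolding direct_summand_def by blast
  have P0: "p = 0" if p: "p \<in> P" for p
  proof -
    from P p have "p \<in> ?M" by (auto simp: dual_submodule_def)
    then obtain q where q: "q \<in> dual" and pq: "p = restr ?D q" by blast
    have "q c = 0" if T: "right.simple T" and c: "c \<in> T" for T c
    proof -
      have subT: "right.submodule T" using T by (simp add: right.simple_def)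
      \<comment> \<open>\<open>f\<close> acts on the dual of the coradical as the projection onto the functionals on \<open>coeff T\<close>\<close>
      have "subspace (coeff T)" "subspace (coeff_complement T)"
        using submodule_coeff[OF subT] submodule_coeff_complement[of T]
        by (simp_all add: right.submodule_def)
      then obtain f where "Vector_Spaces.linear scale (*) f" and f1: "\<forall>a\<in>coeff T. f a = \<epsilon> a"
        and f0: "\<forall>e\<in>coeff_complement T. f e = 0"
        using functional_glued[OF _ _ coeff_disjoint_complement[OF T] counit_linear] by blast
      then have f: "f \<in> dual" by (simp add: dual_def)
      have act: "?act f p = restr ?D (conv f q)"
        using restr_act_restr[OF D f q] by (simp add: pq)
      have "conv f q e = 0" if "e \<in> coeff_complement T" for e
        using f0 lact_coeff_complement[OF q that] apply_lact[OF f, of q e] by simp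
      then have "?act f p \<in> ?R"
        unfolding act by (intro Rat_if_supported_on_coeff[OF T conv_dual[OF f q]] ballI)
      moreover have "?act f p \<in> P" using P p f by (simp add: dual_submodule_def)
      ultimately have "?act f p = 0" using RP by blast
      have cA: "c \<in> coeff T" using subset_coeff c by blast
      then have cD: "c \<in> ?D" using coeff_subset_coradical[OF T] by blast
      have "q c = \<epsilon> (lact q c)"
        using q by (simp add: apply_lact counit_dual conv_counit_left)
      also have "\<dots> = f (lact q c)"
        using f1 coeff_lact[OF subT q cA] by simp
      also have "\<dots> = restr ?D (conv f q) 0 c"
        using cD f by (simp add: restr_def apply_lact)
      also have "\<dots> = 0"
        using \<open>?act f p = 0\<close> by (simp add: act)
      finally show ?thesis .
    qed
    then have "q c = 0" if "c \<in> ?D" for c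
      using functional_vanish_on_span[of q "\<Union>{S. right.simple S}" c] q that
      by (auto simp: coradical_eq dual_def)
    then show ?thesis by (auto simp: pq restr_def fun_eq_iff)
  qed
  have "restr ?D \<epsilon> \<in> ?M" using counit_dual by blast
  then obtain n p where np: "n \<in> ?R" "p \<in> P" "restr ?D \<epsilon> = n + p" using sum by blast
  then have "restr ?D \<epsilon> \<in> ?R" using P0[OF np(2)] by simp
  then obtain t where t: "\<forall>f\<in>dual. ?act f (restr ?D \<epsilon>) = (\<Sum>(x, y)\<leftarrow>t. scale_fun (f y) x)"
    using Rat_expansion[OF left_dual_module_restr[OF D]] by blast
  have "c \<in> span (snd ` set t)" if c: "c \<in> ?D" for c
  proof (rule ccontr)
    assume "c \<notin> span (snd ` set t)"
    then obtain f where f: "f \<in> dual" "\<forall>w\<in>span (snd ` set t). f w = 0" and fc: "f c \<noteq> 0"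
      using functional_separates[OF subspace_span] unfolding dual_def by blast
    have ft: "f (snd l) = 0" if "l \<in> set t" for l
      using f(2) that by (intro bspec[OF f(2)] span_base imageI)
    have "restr ?D f = ?act f (restr ?D \<epsilon>)"
      using f(1) by (simp add: restr_act_restr[OF D] counit_dual conv_counit_right)
    also have "\<dots> = (\<Sum>(x, y)\<leftarrow>t. scale_fun (f y) x)" using t f(1) by blast
    also have "map (\<lambda>(x, y). scale_fun (f y) x) t = map (\<lambda>_. 0) t"
      using ft by (intro map_cong) (auto simp: scale_fun_def fun_eq_iff)
    finally have "restr ?D f 0 c = 0" by simp
    then show False using c fc by (simp add: restr_def)
  qed
  then show thesis using that[of "snd ` set t"] by auto
qed

section \<open>Types of simple comodules\<close>

text \<open>
  Module isomorphisms, for modules that may lie in different spaces, as needed to compare abstract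
  comodules with submodules of \<open>C\<close>.
\<close>

definition equivariant_bij where
  "equivariant_bij s actV V s' actW W h \<longleftrightarrow> bij_betw h V W \<and>
     (\<forall>x\<in>V. \<forall>y\<in>V. h (x + y) = h x + h y) \<and> (\<forall>a. \<forall>x\<in>V. h (s a x) = s' a (h x)) \<and>
     (\<forall>f\<in>dual. \<forall>x\<in>V. h (actV f x) = actW f (h x))"

lemma equivariant_bij_compose:
  assumes "equivariant_bij s actU U s' actV V h" and "equivariant_bij s' actV V s'' actW W k"
  shows "equivariant_bij s actU U s'' actW W (k \<circ> h)"
proof -
  have "h x \<in> V" if "x \<in> U" for x
    using assms(1) that by (auto simp: equivariant_bij_def bij_betw_def)
  then show ?thesis
    using assms unfolding equivariant_bij_def by (auto intro: bij_betw_trans)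
qed

lemma equivariant_bij_inverse:
  assumes h: "equivariant_bij s actV V s' actW W h"
    and closed: "\<And>x y. x \<in> V \<Longrightarrow> y \<in> V \<Longrightarrow> x + y \<in> V" "\<And>a x. x \<in> V \<Longrightarrow> s a x \<in> V"
      "\<And>f x. f \<in> dual \<Longrightarrow> x \<in> V \<Longrightarrow> actV f x \<in> V"
  shows "equivariant_bij s' actW W s actV V (inv_into V h)"
proof -
  have bij: "bij_betw h V W" using h by (simp add: equivariant_bij_def)
  then have inj: "inj_on h V" and W: "W = h ` V" by (auto simp: bij_betw_def)
  have inv: "inv_into V h (h x) = x" if "x \<in> V" for x
    using inj that by simp
  have hom: "\<And>x y. x \<in> V \<Longrightarrow> y \<in> V \<Longrightarrow> h x + h y = h (x + y)"
    "\<And>a x. x \<in> V \<Longrightarrow> s' a (h x) = h (s a x)"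
    "\<And>f x. f \<in> dual \<Longrightarrow> x \<in> V \<Longrightarrow> actW f (h x) = h (actV f x)"
    using h by (simp_all add: equivariant_bij_def)
  show ?thesis
    unfolding equivariant_bij_def
    by (intro conjI bij_betw_inv_into bij ballI allI) (auto simp: W inv hom closed)
qed

lemma isomorphic_iff_equivariant_bij:
  "right.isomorphic S T \<longleftrightarrow> (\<exists>h. equivariant_bij scale ract S scale ract T h)"
  by (simp add: right.isomorphic_def equivariant_bij_def)

text \<open>
  Compatibility of a bijection with the coactions is an equation between tensors; contracting
  the coalgebra factor turns it into equivariance.
\<close>

lemma left_comodule_iso_iff:
  assumes X: "left_comodule sN N \<rho>" and Y: "left_comodule sN N' \<rho>'"
  shows "left_comodule_iso sN (N, \<rho>) (N', \<rho>') \<longleftrightarrow>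
    (\<exists>h. equivariant_bij sN (slice sN \<rho>) N sN (slice sN \<rho>') N' h)"
proof -
  have V: "vector_space sN" and sub: "module.subspace sN N"
    and \<rho>N: "\<And>n. n \<in> N \<Longrightarrow> snd ` set (\<rho> n) \<subseteq> N"
    using X by (auto simp: left_comodule_def)
  interpret V: vector_space sN by (rule V)
  have h_slice: "h (slice sN \<rho> f n) = (\<Sum>(x, y)\<leftarrow>map (\<lambda>(x, y). (x, h y)) (\<rho> n). sN (f x) y)"
    if add: "\<And>x y. x \<in> N \<Longrightarrow> y \<in> N \<Longrightarrow> h (x + y) = h x + h y"
      and scale: "\<And>a x. x \<in> N \<Longrightarrow> h (sN a x) = sN a (h x)" and n: "n \<in> N" for h f n
  proof -
    have h0: "h 0 = 0" using scale[of 0 0] V.subspace_0[OF sub] by simp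
    have in_N: "snd l \<in> N" if "l \<in> set (\<rho> n)" for l using \<rho>N[OF n] that by auto
    have "h (slice sN \<rho> f n) = (\<Sum>l\<leftarrow>\<rho> n. h (sN (f (fst l)) (snd l)))"
      unfolding slice_def case_prod_unfold
      by (rule additive_on_sum_list[where U = N])
        (use sub h0 add in_N in \<open>auto intro: V.subspace_0 V.subspace_add V.subspace_scale\<close>)
    also have "map (\<lambda>l. h (sN (f (fst l)) (snd l))) (\<rho> n) = map (\<lambda>l. sN (f (fst l)) (h (snd l))) (\<rho> n)"
      using scale in_N by simp
    finally show ?thesis by (simp add: case_prod_unfold comp_def)
  qed
  have "(\<forall>n\<in>N. tensor_eq scale sN (map (\<lambda>(x, y). (x, h y)) (\<rho> n)) (\<rho>' (h n))) \<longleftrightarrow>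
      (\<forall>f\<in>dual. \<forall>n\<in>N. h (slice sN \<rho> f n) = slice sN \<rho>' f (h n))"
    if add: "\<And>x y. x \<in> N \<Longrightarrow> y \<in> N \<Longrightarrow> h (x + y) = h x + h y"
      and scale: "\<And>a x. x \<in> N \<Longrightarrow> h (sN a x) = sN a (h x)" for h
  proof (intro iffI ballI)
    fix f n
    assume eq: "\<forall>n\<in>N. tensor_eq scale sN (map (\<lambda>(x, y). (x, h y)) (\<rho> n)) (\<rho>' (h n))"
      and f: "f \<in> dual" and n: "n \<in> N"
    have "h (slice sN \<rho> f n) = (\<Sum>(x, y)\<leftarrow>map (\<lambda>(x, y). (x, h y)) (\<rho> n). sN (f x) y)"
      by (rule h_slice) (use add scale n in auto)
    also have "\<dots> = slice sN \<rho>' f (h n)"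
      unfolding slice_def
      by (rule tensor_eq_sliced[OF eq[rule_format, OF n] vector_space_axioms V])
        (use f in \<open>simp add: dual_def\<close>)
    finally show "h (slice sN \<rho> f n) = slice sN \<rho>' f (h n)" .
  next
    fix n
    assume eq: "\<forall>f\<in>dual. \<forall>n\<in>N. h (slice sN \<rho> f n) = slice sN \<rho>' f (h n)" and n: "n \<in> N"
    show "tensor_eq scale sN (map (\<lambda>(x, y). (x, h y)) (\<rho> n)) (\<rho>' (h n))"
    proof (rule tensor_eqI[OF vector_space_axioms V])
      fix f assume "Vector_Spaces.linear scale (*) f"
      then have "h (slice sN \<rho> f n) = slice sN \<rho>' f (h n)" using eq n by (simp add: dual_def)
      moreover have "h (slice sN \<rho> f n) = (\<Sum>(x, y)\<leftarrow>map (\<lambda>(x, y). (x, h y)) (\<rho> n). sN (f x) y)"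
        by (rule h_slice) (use add scale n in auto)
      ultimately show "(\<Sum>(x, y)\<leftarrow>map (\<lambda>(x, y). (x, h y)) (\<rho> n). sN (f x) y) = (\<Sum>(x, y)\<leftarrow>\<rho>' (h n). sN (f x) y)"
        by (simp add: slice_def)
    qed
  qed
  then show ?thesis
    unfolding left_comodule_iso_def equivariant_bij_def prod.case
    by (intro ex_cong1 conj_cong HOL.refl) simp_all
qed

text \<open>
  For a linear functional \<open>\<theta>\<close> the map \<open>n \<mapsto> n\<^sub>-\<^sub>1 \<theta>(n\<^sub>0)\<close> is a homomorphism into \<open>C\<close>; composed
  with the counit it gives back \<open>\<theta>\<close>, so it is non-zero on \<open>N\<close> if \<open>\<theta>\<close> is.
\<close>

lemma simple_comodule_embeds:
  assumes X: "simple_left_comodule sN (N, \<rho>)"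
  shows "\<exists>e. right.simple (e ` N) \<and> equivariant_bij sN (slice sN \<rho>) N scale ract (e ` N) e"
proof -
  have N: "left_comodule sN N \<rho>" and simple: "simple_left_subcomodule sN N \<rho> N"
    using X by (auto simp: simple_left_comodule_def)
  have V: "vector_space sN" and sub: "module.subspace sN N"
    using N by (auto simp: left_comodule_def)
  interpret V: vector_space sN by (rule V)
  have "N \<noteq> {0}" using simple by (simp add: simple_left_subcomodule_def)
  then obtain n where n: "n \<in> N" "n \<notin> {0}" using V.subspace_0[OF sub] by blast
  obtain \<theta> where "Vector_Spaces.linear sN (*) \<theta>" and \<theta>n: "\<theta> n \<noteq> 0"
    using V.functional_separates[OF V.subspace_single_0 n(2)] by blast
  note \<theta>_lin = this(1)
  then have \<theta>: "\<theta> (x + y) = \<theta> x + \<theta> y" "\<theta> (sN a x) = a * \<theta> x" for x y a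
    using V.functional_iff by auto
  define e where "e = (\<lambda>n. \<Sum>(x, y)\<leftarrow>\<rho> n. scale (\<theta> y) x)"
  have apply_e: "f (e n) = \<theta> (slice sN \<rho> f n)" if "f \<in> dual" for f n
    using that by (simp add: e_def slice_def case_prod_unfold dual_sum_list dual_scale \<theta>
        V.functional_sum_list[OF \<theta>_lin] mult.commute)
  have add: "e (x + y) = e x + e y" if "x \<in> N" "y \<in> N" for x y
    using that by (intro eq_if_dual_eq) (simp add: apply_e dual_add slice_add[OF N] \<theta>)
  have scale: "e (sN a x) = scale a (e x)" if "x \<in> N" for a x
    using that by (intro eq_if_dual_eq) (simp add: apply_e dual_scale slice_scale[OF N] \<theta>)
  have equiv: "e (slice sN \<rho> f x) = ract f (e x)" if f: "f \<in> dual" and x: "x \<in> N" for f x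
  proof (rule eq_if_dual_eq)
    fix g assume g: "g \<in> dual"
    have "g (e (slice sN \<rho> f x)) = \<theta> (slice sN \<rho> (conv f g) x)"
      by (simp add: apply_e g slice_conv[OF N f g x])
    then show "g (e (slice sN \<rho> f x)) = g (ract f (e x))"
      by (simp add: apply_e conv_dual f g flip: apply_ract)
        (simp add: apply_ract apply_e conv_dual f g)
  qed
  have "\<epsilon> (e n) = \<theta> n" by (simp add: apply_e counit_dual slice_counit[OF N n(1)])
  then have "e n \<noteq> 0" using \<theta>n dual_zero[OF counit_dual] by auto
  then have nonzero: "e ` N \<noteq> {0}" using n(1) by blast
  have "inj_on e N \<and> right.simple (e ` N)"
  proof (rule right.simple_image[OF V sub, where actN = "slice sN \<rho>"])
    show "\<forall>f\<in>dual. \<forall>x\<in>N. slice sN \<rho> f x \<in> N" by (simp add: slice_closed[OF N])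
    show "\<forall>P\<subseteq>N. V.subspace P \<and> (\<forall>f\<in>dual. \<forall>x\<in>P. slice sN \<rho> f x \<in> P) \<longrightarrow> P = {0} \<or> P = N"
      using simple by (simp add: simple_left_subcomodule_def left_subcomodule_iff[OF V])
  qed (simp_all add: add scale equiv nonzero)
  then show ?thesis
    unfolding equivariant_bij_def bij_betw_def using add scale equiv by blast
qed

text \<open>
  Isomorphisms between the embedded copies in \<open>C\<close> pull back to isomorphisms of the comodules. So
  representatives of distinct types embed as pairwise non-isomorphic simple submodules of the
  coradical, and there are at most \<open>card W\<close> of these.
\<close>

lemma finite_simple_types:
  assumes W: "finite W" "coradical \<subseteq> span W"
  shows "finite (simple_left_comodule_types sN)"
proof -
  let ?S = "{X. simple_left_comodule sN X}"
  let ?r = "{(X, Y). simple_left_comodule sN X \<and> simple_left_comodule sN Y \<and> left_comodule_iso sN X Y}"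
  let ?eq = "\<lambda>X Y. equivariant_bij sN (slice sN (snd X)) (fst X) sN (slice sN (snd Y)) (fst Y)"
  have comodule: "left_comodule sN (fst X) (snd X)" if "simple_left_comodule sN X" for X
    using that by (auto simp: simple_left_comodule_def split: prod.splits)
  have closed: "x + y \<in> fst X" "sN a x \<in> fst X" "slice sN (snd X) f x \<in> fst X"
    if X: "simple_left_comodule sN X" and xy: "x \<in> fst X" "y \<in> fst X" for X x y a f
  proof -
    interpret V: vector_space sN using comodule[OF X] by (simp add: left_comodule_def)
    have "V.subspace (fst X)" using comodule[OF X] by (simp add: left_comodule_def)
    then show "x + y \<in> fst X" "sN a x \<in> fst X"
      using xy by (auto intro: V.subspace_add V.subspace_scale)
    show "slice sN (snd X) f x \<in> fst X" by (rule slice_closed[OF comodule[OF X] xy(1)])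
  qed
  have r_iff: "(X, Y) \<in> ?r \<longleftrightarrow> X \<in> ?S \<and> Y \<in> ?S \<and> (\<exists>h. ?eq X Y h)" for X Y
    using left_comodule_iso_iff[OF comodule comodule, of X Y] by auto
  have inverse: "?eq Y X (inv_into (fst X) h)" if "?eq X Y h" "X \<in> ?S" for X Y h
    using that closed by (intro equivariant_bij_inverse) auto
  have equiv: "equiv ?S ?r"
  proof (rule equivI)
    show "?r \<subseteq> ?S \<times> ?S" by blast
    show "refl_on ?S ?r"
    proof (rule refl_onI)
      fix X assume "X \<in> ?S"
      moreover have "?eq X X id" by (simp add: equivariant_bij_def)
      ultimately show "(X, X) \<in> ?r" unfolding r_iff by blast
    qed
    show "sym ?r"
      unfolding sym_def r_iff using inverse by blast
    show "trans ?r"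
      unfolding trans_def r_iff using equivariant_bij_compose by blast
  qed
  have "\<exists>e. right.simple (e ` fst X) \<and>
      equivariant_bij sN (slice sN (snd X)) (fst X) scale ract (e ` fst X) e" if "X \<in> ?S" for X
    using simple_comodule_embeds[of sN "fst X" "snd X"] that by simp
  then obtain e where e_simple: "\<And>X. X \<in> ?S \<Longrightarrow> right.simple (e X ` fst X)"
    and e: "\<And>X. X \<in> ?S \<Longrightarrow>
      equivariant_bij sN (slice sN (snd X)) (fst X) scale ract (e X ` fst X) (e X)"
    by metis
  define \<psi> where "\<psi> = (\<lambda>X. e X ` fst X)"
  have iso_reflect: "(X, Y) \<in> ?r"
    if X: "X \<in> ?S" and Y: "Y \<in> ?S" and iso: "right.isomorphic (\<psi> X) (\<psi> Y)" for X Y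
  proof -
    obtain k where "equivariant_bij scale ract (\<psi> X) scale ract (\<psi> Y) k"
      using iso unfolding isomorphic_iff_equivariant_bij by blast
    moreover have "equivariant_bij scale ract (\<psi> Y) sN (slice sN (snd Y)) (fst Y) (inv_into (fst Y) (e Y))"
      unfolding \<psi>_def by (rule equivariant_bij_inverse[OF e[OF Y]]) (use closed Y in auto)
    ultimately have "\<exists>h. ?eq X Y h"
      using e[OF X] unfolding \<psi>_def by (blast intro: equivariant_bij_compose)
    then show ?thesis unfolding r_iff using X Y by blast
  qed
  have "finite (?S // ?r)"
  proof (rule ccontr)
    assume "\<not> ?thesis"
    then obtain Q where Q: "finite Q" "card Q = Suc (card W)" "Q \<subseteq> ?S // ?r"
      using infinite_arbitrarily_large by blast
    have "\<exists>X. X \<in> ?S \<and> q = ?r `` {X}" if "q \<in> Q" for q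
    proof -
      have "q \<in> ?S // ?r" using that Q(3) by blast
      then show ?thesis by (elim quotientE) blast
    qed
    then have "\<forall>q\<in>Q. \<exists>X. X \<in> ?S \<and> q = ?r `` {X}" by (rule ballI)
    then obtain x where rep: "\<forall>q\<in>Q. x q \<in> ?S \<and> q = ?r `` {x q}"
      by (rule bchoice[THEN exE])
    have x: "x q \<in> ?S" "q = ?r `` {x q}" if "q \<in> Q" for q
      using bspec[OF rep that] by (rule conjunct1, rule conjunct2)
    have reflect: "q = q'" if q: "q \<in> Q" "q' \<in> Q" and iso: "right.isomorphic (\<psi> (x q)) (\<psi> (x q'))" for q q'
    proof -
      have "?r `` {x q} = ?r `` {x q'}"
        by (rule equiv_class_eq[OF equiv iso_reflect[OF x(1)[OF q(1)] x(1)[OF q(2)] iso]])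
      then show ?thesis using x(2)[OF q(1)] x(2)[OF q(2)] by simp
    qed
    have refl: "right.isomorphic S S" for S
      unfolding isomorphic_iff_equivariant_bij
      by (rule exI[of _ id]) (simp add: equivariant_bij_def)
    let ?\<X> = "(\<psi> \<circ> x) ` Q"
    have "inj_on (\<psi> \<circ> x) Q"
    proof (rule inj_onI)
      fix q q' assume q: "q \<in> Q" "q' \<in> Q" and "(\<psi> \<circ> x) q = (\<psi> \<circ> x) q'"
      then have "right.isomorphic (\<psi> (x q)) (\<psi> (x q'))" using refl[of "\<psi> (x q)"] by simp
      then show "q = q'" by (rule reflect[OF q])
    qed
    then have "card ?\<X> = card Q" by (rule card_image)
    moreover have "card ?\<X> \<le> card W"
    proof (rule right.card_nonisomorphic_simples_le)
      show "finite ?\<X>" "finite W" using Q(1) W(1) by simp_all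
      show simples: "\<forall>X\<in>?\<X>. right.simple X"
        using e_simple x(1) by (auto simp: \<psi>_def)
      show "\<forall>X\<in>?\<X>. \<forall>Y\<in>?\<X>. right.isomorphic X Y \<longrightarrow> X = Y"
        using reflect by auto
      have "\<Union>?\<X> \<subseteq> coradical"
        unfolding coradical_eq
        by (rule subset_trans[OF Union_mono span_superset]) (use simples in blast)
      then show "\<Union>?\<X> \<subseteq> span W" using W(2) by blast
    qed
    ultimately show False using Q(2) by simp
  qed
  then show ?thesis by (simp add: simple_left_comodule_types_def)
qed

end

theorem proposition1p3:
  fixes scale :: "'k::field \<Rightarrow> 'c::ab_group_add \<Rightarrow> 'c"
    and \<Delta> :: "'c \<Rightarrow> ('c \<times> 'c) list"
    and \<epsilon> :: "'c \<Rightarrow> 'k"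
    and sN :: "'k \<Rightarrow> 'n::ab_group_add \<Rightarrow> 'n"
  assumes "coalgebra scale \<Delta> \<epsilon>"
    and "\<forall>(M :: (nat \<Rightarrow> 'c \<Rightarrow> 'k) set) act.
           coalgebra.left_dual_module scale \<Delta> \<epsilon> scale_fun M act \<and>
           coalgebra.finitely_generated scale M act \<longrightarrow>
           coalgebra.direct_summand scale scale_fun M act
             (coalgebra.Rat scale \<Delta> \<epsilon> scale_fun M act)"
    and "vector_space sN"
  shows "finite (coalgebra.simple_left_comodule_types scale \<Delta> \<epsilon> sN) \<and>
         finite_dim scale (coalgebra.coradical scale \<Delta>)"
proof -
  interpret coalgebra scale \<Delta> \<epsilon> by (rule assms(1))
  have "direct_summand scale_fun (restr coradical ` dual) (restr_act coradical)
      (Rat scale_fun (restr coradical ` dual) (restr_act coradical))"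
    by (rule assms(2)[THEN spec, THEN spec, THEN mp])
      (intro conjI left_dual_module_restr finitely_generated_restr submodule_coradical)
  then obtain W where W: "finite W" "coradical \<subseteq> span W"
    by (rule coradical_in_finite_span)
  obtain B where B: "B \<subseteq> coradical" "independent B" "coradical \<subseteq> span B"
    using maximal_independent_subset by blast
  have "B \<subseteq> span W" using B(1) W(2) by blast
  then have "finite B" using independent_span_bound[OF W(1) B(2)] by blast
  moreover have "coradical = span B"
    using span_subspace[OF B(1,3)] by (simp add: coradical_def)
  ultimately have "finite_dim scale coradical"
    unfolding finite_dim_def by blast
  then show ?thesis using finite_simple_types[OF W] by blast
qed

end
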